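(* Let $n\ge1$, let $0\le\alpha<n$, and fix a (bounded) cube $Q_0\subset\mathbb R^n$ with sides parallel to the coordinate axes. Let $f\in\mathrm{BMO}(Q_0)$. Then $M^\alpha f\in\mathrm{BLO}(Q_0)$ with $$\|M^\alpha f\|_{\mathrm{BLO}(Q_0)}\le C\,\|f\|_{\mathrm{BMO}(Q_0)},$$ where, $Q_0$ being fixed, the constant $C$ depends on $n$ and $\alpha$ (and not on $f$). Moreover, if $f\in\mathrm{VMO}(Q_0)$, then $M^\alpha f\in\mathrm{VMO}(Q_0)$.
   Context: The cube $X=Q_0$ is regarded as a metric measure space with the Euclidean metric and Lebesgue measure $\mu$; its balls are the sets $B(x,r)\cap Q_0$ with $x\in Q_0$, $r>0$, where $B(x,r)$ is the Euclidean ball, and such a ball has radius $r$. For $f$ locally integrable on $Q_0$ (integrable on balls), write $f_B=\frac1{\mu(B)}\int_B f\,d\mu$ and $\mathcal O(f,B)=\frac1{\mu(B)}\int_B|f-f_B|\,d\mu$. $\mathrm{BMO}(Q_0)$ is the set of such $f$ with $\|f\|_{\mathrm{BMO}(Q_0)}:=\sup_B\mathcal O(f,B)<\infty$, supremum over all balls $B$ of $Q_0$. $\mathrm{BLO}(Q_0)$ is the set of such $f$ with $\|f\|_{\mathrm{BLO}(Q_0)}:=\sup_B\frac1{\mu(B)}\int_B[f-\operatorname{ess\,inf}_Bf]\,d\mu<\infty$. $\mathrm{VMO}(Q_0)$ is the set of $f\in\mathrm{BMO}(Q_0)$ with $\lim_{r\to0^+}\sup_{\mathrm{rad}(B)\le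 r}\mathcal O(f,B)=0$. (Using subcubes of $Q_0$ with sides parallel to the axes, and vanishing side length for $\mathrm{VMO}$, in place of balls gives the same spaces, with norms equivalent up to dimensional constants.) The fractional maximal function is $M^\alpha f(x)=\sup_{B\ni x}\mathrm{rad}(B)^\alpha\frac1{\mu(B)}\int_B|f|\,d\mu$, the supremum being over all balls $B$ of $Q_0$ containing $x\in Q_0$ with $0<\mathrm{rad}(B)<2\,\mathrm{diam}(Q_0)$. *)

theory Defs
  imports "HOL-Analysis.Analysis" "HOL-Probability.Essential_Supremum"
begin

text \<open>
  An axis-parallel cube is a product of intervals of one common length \<open>l > 0\<close>.
  Each interval may be open, half-open or closed.
\<close>

definition is_cube :: "(real ^ 'n) set \<Rightarrow> bool" where
  "is_cube Q \<longleftrightarrow> (\<exists>(a :: real ^ 'n) l I. 0 < l \<and>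
     (\<forall>i. {a $ i <..< a $ i + l} \<subseteq> I i \<and> I i \<subseteq> {a $ i .. a $ i + l}) \<and>
     Q = {x. \<forall>i. x $ i \<in> I i})"

text \<open>
  Different pairs of a centre and a radius can give the same set \<open>qball Q x r\<close>. A ball is
  therefore represented by its pair \<open>(x, r)\<close>, and the second component is what the radius of
  the ball means.
\<close>

definition qball :: "'a::euclidean_space set \<Rightarrow> 'a \<Rightarrow> real \<Rightarrow> 'a set" where
  "qball Q x r = ball x r \<inter> Q"

definition qballs :: "'a::euclidean_space set \<Rightarrow> ('a \<times> real) set" where
  "qballs Q = {(x, r). x \<in> Q \<and> 0 < r}"

definition loc_integrable :: "'a::euclidean_space set \<Rightarrow> ('a \<Rightarrow> real) \<Rightarrow> bool" where
  "loc_integrable Q f \<longleftrightarrow> (\<forall>(x, r) \<in> qballs Q. set_integrable lebesgue (qball Q x r) f)"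

definition avg :: "'a::euclidean_space set \<Rightarrow> ('a \<Rightarrow> real) \<Rightarrow> real" where
  "avg B f = (1 / measure lebesgue B) * (LINT y:B|lebesgue. f y)"

definition mean_osc :: "('a::euclidean_space \<Rightarrow> real) \<Rightarrow> 'a set \<Rightarrow> real" where
  "mean_osc f B = avg B (\<lambda>y. \<bar>f y - avg B f\<bar>)"

definition bmo_norm :: "'a::euclidean_space set \<Rightarrow> ('a \<Rightarrow> real) \<Rightarrow> ennreal" where
  "bmo_norm Q f = (SUP (x, r) \<in> qballs Q. ennreal (mean_osc f (qball Q x r)))"

definition BMO :: "'a::euclidean_space set \<Rightarrow> ('a \<Rightarrow> real) set" where
  "BMO Q = {f. loc_integrable Q f \<and> bmo_norm Q f < \<infinity>}"

definition ess_inf :: "'a::euclidean_space set \<Rightarrow> ('a \<Rightarrow> real) \<Rightarrow> ereal" where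
  "ess_inf B f = - esssup (lebesgue_on B) (\<lambda>y. - ereal (f y))"

text \<open>
  The integrand below is nonnegative almost everywhere on \<open>B\<close>, so the truncation in
  \<^const>\<open>e2ennreal\<close> only acts on a null set. If the essential infimum is
  \<open>-\<infinity>\<close>, the value is \<open>\<infinity>\<close>.
\<close>

definition mean_above_inf :: "('a::euclidean_space \<Rightarrow> real) \<Rightarrow> 'a set \<Rightarrow> ennreal" where
  "mean_above_inf f B =
     (\<integral>\<^sup>+ y \<in> B. e2ennreal (ereal (f y) - ess_inf B f) \<partial>lebesgue) / emeasure lebesgue B"

definition blo_norm :: "'a::euclidean_space set \<Rightarrow> ('a \<Rightarrow> real) \<Rightarrow> ennreal" where
  "blo_norm Q f = (SUP (x, r) \<in> qballs Q. mean_above_inf f (qball Q x r))"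

definition BLO :: "'a::euclidean_space set \<Rightarrow> ('a \<Rightarrow> real) set" where
  "BLO Q = {f. loc_integrable Q f \<and> blo_norm Q f < \<infinity>}"

definition VMO :: "'a::euclidean_space set \<Rightarrow> ('a \<Rightarrow> real) set" where
  "VMO Q = {f \<in> BMO Q.
     ((\<lambda>r. SUP (x, s) \<in> {(x, s) \<in> qballs Q. s \<le> r}. ennreal (mean_osc f (qball Q x s)))
        \<longlongrightarrow> 0) (at_right 0)}"

text \<open>The supremum can be infinite at some points, even when \<open>f\<close> is in \<open>BMO Q\<close>.\<close>

definition frac_max :: "real \<Rightarrow> 'a::euclidean_space set \<Rightarrow> ('a \<Rightarrow> real) \<Rightarrow> 'a \<Rightarrow> ennreal" where
  "frac_max \<alpha> Q f x =
     (SUP (y, r) \<in> {(y, r) \<in> qballs Q. r < 2 * diameter Q \<and> x \<in> qball Q y r}.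
        ennreal (r powr \<alpha> * avg (qball Q y r) (\<lambda>z. \<bar>f z\<bar>)))"

text \<open>
  Real-valued representative of an extended-valued function. It agrees with \<open>g\<close> almost
  everywhere exactly when \<open>g\<close> is finite almost everywhere, so membership of
  \<open>real_rep g\<close> in a function space says something about \<open>g\<close> only together with that
  finiteness.
\<close>

definition real_rep :: "('a \<Rightarrow> ennreal) \<Rightarrow> 'a \<Rightarrow> real" where
  "real_rep g x = enn2real (g x)"

end

theory Submission
  imports Defs
begin

text \<open>
  Only the doubling property of \<open>Q\<close> matters for the BLO bound. Split the supremum defining
  \<open>M\<^sup>\<alpha> f(x)\<close>, for \<open>x\<close> in a ball \<open>B\<close> of radius \<open>r\<close>, at radius \<open>r\<close>. A ball of radius
  \<open>s > r\<close> containing \<open>x\<close> becomes, after enlarging the radius to \<open>s + 2r\<close>, a competitor at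
  every point \<open>z \<in> B\<close>; by doubling the average of \<open>|f|\<close> changes by at most a multiple of the
  oscillation, so this part is at most \<open>M\<^sup>\<alpha> f(z)\<close> plus a constant. A ball of radius \<open>s \<le> r\<close>
  contributes at most the local maximal function of \<open>f - c\<close>, with \<open>c\<close> the mean of \<open>f\<close> over
  \<open>3B\<close>, plus \<open>s\<^sup>\<alpha> |c|\<close>, and the latter is again at most \<open>M\<^sup>\<alpha> f(z)\<close>.

  The mean over \<open>B\<close> of that local maximal function is bounded by a multiple of the
  oscillation on balls of radius at most \<open>3r\<close>. Neither the John--Nirenberg inequality nor
  Lebesgue differentiation is needed: a Vitali covering of a superlevel set by stopping balls
  reduces the estimate on \<open>B\<close> to the same estimate on much smaller balls of small total
  measure.

  For VMO the same splitting is used on small balls; balls of radius bounded below, which have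
  no small oscillation, change by a set of small measure when the radius grows by \<open>2r\<close>.
\<close>

section \<open>Averages and oscillations\<close>

lemma set_integrable_const_lmeasurable:
  fixes c :: real
  assumes "B \<in> lmeasurable"
  shows "set_integrable lebesgue B (\<lambda>_. c)"
  using assms by (auto simp: set_integrable_def fmeasurable_def)

lemma set_integrable_abs_diff_const:
  fixes f :: "'a::euclidean_space \<Rightarrow> real"
  assumes "B \<in> lmeasurable" "set_integrable lebesgue B f"
  shows "set_integrable lebesgue B (\<lambda>y. \<bar>f y - c\<bar>)"
  using assms by (intro set_integrable_abs set_integral_diff set_integrable_const_lmeasurable)

lemma avg_nonneg:
  assumes "\<And>y. y \<in> B \<Longrightarrow> 0 \<le> f y"
  shows "0 \<le> avg B f"
  using assms by (auto simp: avg_def set_lebesgue_integral_def indicator_def intro!: divide_nonneg_nonneg integral_nonneg)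

lemma mean_osc_nonneg: "0 \<le> mean_osc f B"
  by (simp add: mean_osc_def avg_nonneg)

lemma avg_mono:
  assumes "set_integrable lebesgue B f" "set_integrable lebesgue B g" "\<And>y. y \<in> B \<Longrightarrow> f y \<le> g y"
  shows "avg B f \<le> avg B g"
  unfolding avg_def by (intro mult_left_mono set_integral_mono assms) auto

lemma avg_add_const:
  assumes "B \<in> lmeasurable" "0 < measure lebesgue B" "set_integrable lebesgue B f"
  shows "avg B (\<lambda>y. f y + c) = avg B f + c"
proof -
  have "(LINT y:B|lebesgue. f y + c) = (LINT y:B|lebesgue. f y) + measure lebesgue B * c"
    using assms set_integral_const[of B lebesgue c]
    by (subst set_integral_add) (auto simp: set_integrable_const_lmeasurable fmeasurable_def)
  then show ?thesis using assms by (simp add: avg_def field_simps)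
qed

lemma abs_avg_le: "\<bar>avg B f\<bar> \<le> avg B (\<lambda>y. \<bar>f y\<bar>)"
proof -
  have "\<bar>LINT y:B|lebesgue. f y\<bar> \<le> (LINT y:B|lebesgue. \<bar>f y\<bar>)"
    unfolding set_lebesgue_integral_def
    by (rule order_trans[OF integral_abs_bound]) (simp add: abs_mult)
  then show ?thesis by (simp add: avg_def abs_mult divide_right_mono)
qed

lemma abs_avg_diff_const_le:
  assumes "B \<in> lmeasurable" "0 < measure lebesgue B" "set_integrable lebesgue B f"
  shows "\<bar>avg B f - c\<bar> \<le> avg B (\<lambda>y. \<bar>f y - c\<bar>)"
  using abs_avg_le[of B "\<lambda>y. f y - c"] avg_add_const[OF assms, of "-c"] by simp

lemma avg_abs_diff_const_le:
  assumes "B \<in> lmeasurable" "0 < measure lebesgue B" "set_integrable lebesgue B f"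
  shows "avg B (\<lambda>y. \<bar>f y - c\<bar>) \<le> avg B (\<lambda>y. \<bar>f y - d\<bar>) + \<bar>d - c\<bar>"
proof -
  have "avg B (\<lambda>y. \<bar>f y - c\<bar>) \<le> avg B (\<lambda>y. \<bar>f y - d\<bar> + \<bar>d - c\<bar>)"
    by (intro avg_mono set_integral_add set_integrable_abs_diff_const set_integrable_const_lmeasurable assms) auto
  then show ?thesis
    by (subst (asm) avg_add_const) (auto intro: set_integrable_abs_diff_const assms)
qed

lemma set_integral_mono_set_nonneg:
  fixes g :: "'a \<Rightarrow> real"
  assumes "B \<in> sets M" "B \<subseteq> B'" "set_integrable M B' g" "\<And>y. y \<in> B' \<Longrightarrow> 0 \<le> g y"
  shows "(LINT y:B|M. g y) \<le> (LINT y:B'|M. g y)"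
proof -
  have "set_integrable M B g"
    using assms by (blast intro: set_integrable_subset)
  then show ?thesis
    unfolding set_lebesgue_integral_def using assms unfolding set_integrable_def
    by (intro integral_mono) (auto simp: indicator_def)
qed

lemma avg_subset_le:
  assumes "B \<in> lmeasurable" "0 < measure lebesgue B" "B \<subseteq> B'" "0 < measure lebesgue B'"
    and K: "measure lebesgue B' \<le> K * measure lebesgue B"
    and "set_integrable lebesgue B' g" "\<And>y. y \<in> B' \<Longrightarrow> 0 \<le> g y"
  shows "avg B g \<le> K * avg B' g"
proof -
  let ?I = "LINT y:B'|lebesgue. g y"
  have I0: "0 \<le> ?I" using assms by (auto simp: set_lebesgue_integral_def indicator_def intro!: integral_nonneg)
  have "avg B g \<le> ?I / measure lebesgue B"
    unfolding avg_def using set_integral_mono_set_nonneg[of B lebesgue B' g] assms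
    by (simp add: fmeasurable_def divide_right_mono)
  also have "\<dots> \<le> ?I / (measure lebesgue B' / K)"
  proof (intro divide_left_mono I0)
    have "0 < K" using K assms by (smt (verit) zero_less_mult_pos2 mult_nonpos_nonneg)
    then show "measure lebesgue B' / K \<le> measure lebesgue B"
      "0 < measure lebesgue B * (measure lebesgue B' / K)"
      using assms by (auto simp: field_simps)
  qed
  finally show ?thesis by (simp add: avg_def field_simps)
qed

text \<open>Passing through the mean of \<open>f\<close> over \<open>B'\<close> puts the factor
  \<open>K\<close> on the oscillation alone. The coefficient 1 of the last average is what later
  allows a comparison with the maximal function at another point without loss.\<close>

lemma avg_abs_diff_subset_le:
  assumes "B \<in> lmeasurable" "0 < measure lebesgue B" "B \<subseteq> B'" "B' \<in> lmeasurable" "0 < measure lebesgue B'"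
    and K: "measure lebesgue B' \<le> K * measure lebesgue B"
    and f: "set_integrable lebesgue B' f"
  shows "avg B (\<lambda>y. \<bar>f y - c\<bar>) \<le> K * mean_osc f B' + avg B' (\<lambda>y. \<bar>f y - c\<bar>)"
proof -
  have fB: "set_integrable lebesgue B f"
    using assms by (auto intro: set_integrable_subset simp: fmeasurable_def)
  have "avg B (\<lambda>y. \<bar>f y - c\<bar>) \<le> avg B (\<lambda>y. \<bar>f y - avg B' f\<bar>) + \<bar>avg B' f - c\<bar>"
    by (intro avg_abs_diff_const_le assms fB)
  also have "\<bar>avg B' f - c\<bar> \<le> avg B' (\<lambda>y. \<bar>f y - c\<bar>)"
    by (intro abs_avg_diff_const_le assms)
  also have "avg B (\<lambda>y. \<bar>f y - avg B' f\<bar>) \<le> K * mean_osc f B'"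
    unfolding mean_osc_def
    by (intro avg_subset_le set_integrable_abs_diff_const assms) auto
  finally show ?thesis by simp
qed

lemma mean_osc_le_twice:
  assumes "B \<in> lmeasurable" "0 < measure lebesgue B" "set_integrable lebesgue B f"
  shows "mean_osc f B \<le> 2 * avg B (\<lambda>y. \<bar>f y - c\<bar>)"
proof -
  have "mean_osc f B \<le> avg B (\<lambda>y. \<bar>f y - c\<bar>) + \<bar>c - avg B f\<bar>"
    unfolding mean_osc_def by (intro avg_abs_diff_const_le assms)
  also have "\<bar>c - avg B f\<bar> \<le> avg B (\<lambda>y. \<bar>f y - c\<bar>)"
    using abs_avg_diff_const_le[OF assms, of c] by simp
  finally show ?thesis by simp
qed

lemma nn_set_integral_eq_avg:
  fixes g :: "'a::euclidean_space \<Rightarrow> real"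
  assumes "B \<in> lmeasurable" "0 < measure lebesgue B" "set_integrable lebesgue B g" "\<And>y. y \<in> B \<Longrightarrow> 0 \<le> g y"
  shows "(\<integral>\<^sup>+y\<in>B. ennreal (g y) \<partial>lebesgue) = ennreal (avg B g) * emeasure lebesgue B"
proof -
  have "(\<integral>\<^sup>+y\<in>B. ennreal (g y) \<partial>lebesgue) = (\<integral>\<^sup>+y. ennreal (indicator B y *\<^sub>R g y) \<partial>lebesgue)"
    by (intro nn_integral_cong) (auto simp: indicator_def)
  also have "\<dots> = ennreal (LINT y:B|lebesgue. g y)"
    unfolding set_lebesgue_integral_def using assms
    by (intro nn_integral_eq_integral) (auto simp: set_integrable_def indicator_def)
  also have "(LINT y:B|lebesgue. g y) = avg B g * measure lebesgue B"
    using assms by (simp add: avg_def)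
  also have "ennreal \<dots> = ennreal (avg B g) * emeasure lebesgue B"
    using assms by (simp add: ennreal_mult'' emeasure_eq_measure2)
  finally show ?thesis .
qed

section \<open>Doubling domains\<close>

text \<open>What the argument takes from the cube. Doubling is asked at every radius; beyond the
  diameter both balls are \<open>Q\<close>, so there it only says that \<open>D\<close> is at least
  1, and \<open>measure_qball_le\<close> needs no upper bound on the radii.\<close>

locale doubling_domain =
  fixes Q :: "'a::euclidean_space set" and D :: real
  assumes Q_lmeasurable: "Q \<in> lmeasurable"
    and Q_bounded: "bounded Q"
    and Q_nonempty: "Q \<noteq> {}"
    and Q_diameter_pos: "0 < diameter Q"
    and qball_pos: "\<lbrakk>x \<in> Q; 0 < r\<rbrakk> \<Longrightarrow> 0 < measure lebesgue (qball Q x r)"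
    and doubling: "\<lbrakk>x \<in> Q; 0 < r\<rbrakk> \<Longrightarrow>
      measure lebesgue (qball Q x (2 * r)) \<le> D * measure lebesgue (qball Q x r)"
begin

lemma qball_lmeasurable: "qball Q x r \<in> lmeasurable"
  unfolding qball_def by (intro fmeasurable.Int Q_lmeasurable) simp

lemma qball_sets [measurable, simp]: "qball Q x r \<in> sets lebesgue"
  using qball_lmeasurable by (auto simp: fmeasurable_def)

lemma qball_mono: "r \<le> s \<Longrightarrow> qball Q x r \<subseteq> qball Q x s"
  by (auto simp: qball_def)

lemma qball_shift: "dist x y + r \<le> s \<Longrightarrow> qball Q x r \<subseteq> qball Q y s"
  by (auto simp: qball_def) (smt (verit, best) dist_commute dist_triangle)

lemma mem_qball: "y \<in> qball Q x r \<longleftrightarrow> y \<in> Q \<and> dist x y < r"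
  by (auto simp: qball_def)

lemma measure_qball_mono:
  "qball Q x r \<subseteq> qball Q y s \<Longrightarrow> measure lebesgue (qball Q x r) \<le> measure lebesgue (qball Q y s)"
  by (intro measure_mono_fmeasurable qball_lmeasurable) auto

lemma D_ge_1: "1 \<le> D"
proof -
  obtain x where x: "x \<in> Q" using Q_nonempty by auto
  have "measure lebesgue (qball Q x 1) \<le> measure lebesgue (qball Q x (2 * 1))"
    by (intro measure_qball_mono qball_mono) auto
  also have "\<dots> \<le> D * measure lebesgue (qball Q x 1)" using x by (intro doubling) auto
  finally show ?thesis using qball_pos[OF x, of 1] by simp
qed

lemma doubling_power:
  assumes "x \<in> Q" "0 < r"
  shows "measure lebesgue (qball Q x (2 ^ k * r)) \<le> D ^ k * measure lebesgue (qball Q x r)"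
proof (induction k)
  case (Suc k)
  have "measure lebesgue (qball Q x (2 ^ Suc k * r)) \<le> D * measure lebesgue (qball Q x (2 ^ k * r))"
    using doubling[of x "2 ^ k * r"] assms by (simp add: mult.assoc)
  also have "\<dots> \<le> D * (D ^ k * measure lebesgue (qball Q x r))"
    using Suc.IH D_ge_1 by (intro mult_left_mono) auto
  finally show ?case by (simp add: mult.assoc)
qed auto

text \<open>The ball about \<open>y\<close> lies in the \<open>2 ^ k\<close>-fold dilate of the ball
  about \<open>x\<close>. The powers of \<open>D\<close> in the maximal function estimates arise
  here, \<open>k\<close> being a number of doublings that suffices to absorb the other ball.\<close>

lemma measure_qball_le:
  assumes "x \<in> Q" "0 < r" "dist y x + s \<le> 2 ^ k * r"
  shows "measure lebesgue (qball Q y s) \<le> D ^ k * measure lebesgue (qball Q x r)"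
  using measure_qball_mono[OF qball_shift[OF assms(3)]] doubling_power[OF assms(1,2), of k] by linarith

lemma emeasure_qball_le:
  assumes "x \<in> Q" "0 < r" "dist y x + s \<le> 2 ^ k * r"
  shows "emeasure lebesgue (qball Q y s) \<le> ennreal (D ^ k) * emeasure lebesgue (qball Q x r)"
  using measure_qball_le[OF assms] D_ge_1
  by (simp add: emeasure_eq_measure2[OF qball_lmeasurable] ennreal_mult[symmetric] ennreal_leI)

lemma dist_le_diameter: "x \<in> Q \<Longrightarrow> y \<in> Q \<Longrightarrow> dist x y \<le> diameter Q"
  using diameter_bounded_bound[OF Q_bounded] by blast

lemma qball_eq_Q: "x \<in> Q \<Longrightarrow> diameter Q < r \<Longrightarrow> qball Q x r = Q"
  using dist_le_diameter by (fastforce simp: mem_qball)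

lemma measure_Q_pos: "0 < measure lebesgue Q"
proof -
  obtain x where x: "x \<in> Q" using Q_nonempty by auto
  show ?thesis
    using qball_pos[OF x, of "diameter Q + 1"] qball_eq_Q[OF x, of "diameter Q + 1"] Q_diameter_pos by simp
qed

text \<open>Since \<open>Q\<close> is bounded, it is itself one of its balls.\<close>

lemma loc_integrable_iff: "loc_integrable Q f \<longleftrightarrow> set_integrable lebesgue Q f"
proof
  assume "loc_integrable Q f"
  moreover obtain x where x: "x \<in> Q" using Q_nonempty by auto
  ultimately have "set_integrable lebesgue (qball Q x (diameter Q + 1)) f"
    using Q_diameter_pos by (auto simp: loc_integrable_def qballs_def)
  then show "set_integrable lebesgue Q f" by (simp add: qball_eq_Q x)
next
  assume "set_integrable lebesgue Q f"
  then show "loc_integrable Q f"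
    unfolding loc_integrable_def by (auto intro: set_integrable_subset simp: qball_def[symmetric] mem_qball)
qed

text \<open>A superlevel set is a union of open balls intersected with \<open>Q\<close>, so the
  uncountable supremum causes no measurability problem.\<close>

lemma borel_measurable_SUP_qball:
  fixes w :: "'a \<times> real \<Rightarrow> ennreal"
  assumes "S \<subseteq> qballs Q"
  shows "(\<lambda>x. SUP b\<in>{b\<in>S. x \<in> qball Q (fst b) (snd b)}. w b) \<in> borel_measurable lebesgue"
proof (rule borel_measurableI_greater)
  fix t :: ennreal
  have "{x. t < (SUP b\<in>{b\<in>S. x \<in> qball Q (fst b) (snd b)}. w b)}
      = (\<Union>b\<in>{b\<in>S. t < w b}. ball (fst b) (snd b)) \<inter> Q"
    by (auto simp: less_SUP_iff qball_def) blast
  moreover have "open (\<Union>b\<in>{b\<in>S. t < w b}. ball (fst b) (snd b))" by auto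
  ultimately show "{x \<in> space lebesgue. t < (SUP b\<in>{b\<in>S. x \<in> qball Q (fst b) (snd b)}. w b)} \<in> sets lebesgue"
    using Q_lmeasurable by (auto simp: fmeasurable_def)
qed

end

section \<open>The local maximal function\<close>

text \<open>Sums over the countable Vitali family are written as integrals against counting measure,
  which allows sum and integral to be interchanged without enumerating the family.\<close>

lemma borel_measurable_nn_integral_count_space:
  fixes h :: "'i \<Rightarrow> 'a \<Rightarrow> ennreal"
  assumes "countable I" and h: "\<And>i. i \<in> I \<Longrightarrow> h i \<in> borel_measurable M"
  shows "(\<lambda>x. \<integral>\<^sup>+i. h i x \<partial>count_space I) \<in> borel_measurable M"
proof -
  have "(\<lambda>p. h (snd p) (fst p)) \<in> borel_measurable (M \<Otimes>\<^sub>M count_space I)"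
    by (rule measurable_compose_countable'[OF _ measurable_snd \<open>countable I\<close>])
      (rule measurable_compose[OF measurable_fst h])
  then show ?thesis
    by (intro sigma_finite_measure.borel_measurable_nn_integral sigma_finite_measure_count_space_countable assms)
      (simp add: case_prod_beta')
qed

text \<open>The lower cut-off \<open>e\<close> gives an induction on scale its starting point and is
  later sent to 0. The supremum ranges over filtered pairs to match
  \<open>borel_measurable_SUP_qball\<close>.\<close>

definition local_max :: "'a::euclidean_space set \<Rightarrow> ('a \<Rightarrow> real) \<Rightarrow> real \<Rightarrow> real \<Rightarrow> real \<Rightarrow> 'a \<Rightarrow> ennreal" where
  "local_max Q f c e r x =
     (SUP b \<in> {b \<in> {(y, s) \<in> qballs Q. e < s \<and> s \<le> r}. x \<in> qball Q (fst b) (snd b)}.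
        ennreal (avg (qball Q (fst b) (snd b)) (\<lambda>z. \<bar>f z - c\<bar>)))"

lemma local_max_upper:
  assumes "y \<in> Q" "0 < s" "e < s" "s \<le> r" "x \<in> qball Q y s"
  shows "ennreal (avg (qball Q y s) (\<lambda>z. \<bar>f z - c\<bar>)) \<le> local_max Q f c e r x"
  unfolding local_max_def using assms by (intro SUP_upper2[of "(y, s)"]) (auto simp: qballs_def)

lemma local_max_least:
  assumes "\<And>y s. \<lbrakk>y \<in> Q; 0 < s; e < s; s \<le> r; x \<in> qball Q y s\<rbrakk> \<Longrightarrow>
    ennreal (avg (qball Q y s) (\<lambda>z. \<bar>f z - c\<bar>)) \<le> t"
  shows "local_max Q f c e r x \<le> t"
  unfolding local_max_def using assms by (intro SUP_least) (auto simp: qballs_def)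

lemma less_local_maxD:
  assumes "ennreal t < local_max Q f c e r x" "0 \<le> t"
  shows "\<exists>y s. y \<in> Q \<and> 0 < s \<and> e < s \<and> s \<le> r \<and> x \<in> qball Q y s \<and> t < avg (qball Q y s) (\<lambda>z. \<bar>f z - c\<bar>)"
  using assms by (auto simp: local_max_def less_SUP_iff qballs_def ennreal_less_iff)

context doubling_domain
begin

lemma borel_measurable_local_max [measurable]: "local_max Q f c e r \<in> borel_measurable lebesgue"
  unfolding local_max_def[abs_def] by (intro borel_measurable_SUP_qball) auto

lemma set_integrable_qball:
  fixes f :: "'a \<Rightarrow> real"
  shows "set_integrable lebesgue Q f \<Longrightarrow> set_integrable lebesgue (qball Q x r) f"
  by (rule set_integrable_subset) (auto simp: qball_def[symmetric] mem_qball)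

text \<open>The supremum of the radii whose average exceeds \<open>t\<close> need not be attained,
  so a radius above half of it is taken. Any radius beyond \<open>2 * \<rho>\<close> then lies above
  the supremum. The cut-off \<open>e\<close> keeps the supremum positive.\<close>

lemma exists_near_maximal_ball:
  assumes "ennreal t < local_max Q f c e r x" "0 \<le> t" "0 < e"
  shows "\<exists>y \<rho>. y \<in> Q \<and> e < \<rho> \<and> \<rho> \<le> r \<and> x \<in> qball Q y \<rho> \<and> t < avg (qball Q y \<rho>) (\<lambda>z. \<bar>f z - c\<bar>) \<and>
    (\<forall>z s. z \<in> Q \<longrightarrow> 2 * \<rho> < s \<longrightarrow> s \<le> r \<longrightarrow> x \<in> qball Q z s \<longrightarrow> avg (qball Q z s) (\<lambda>z. \<bar>f z - c\<bar>) \<le> t)"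
proof -
  define S where "S = {s. \<exists>y\<in>Q. e < s \<and> s \<le> r \<and> x \<in> qball Q y s \<and> t < avg (qball Q y s) (\<lambda>z. \<bar>f z - c\<bar>)}"
  have bdd: "bdd_above S" by (rule bdd_aboveI[of _ r]) (auto simp: S_def)
  obtain s0 where s0: "s0 \<in> S" using less_local_maxD[OF assms(1,2)] by (auto simp: S_def)
  then have "0 < s0" using assms by (auto simp: S_def)
  then have "0 < Sup S" using cSup_upper[OF s0 bdd] by simp
  then obtain \<rho> where \<rho>: "\<rho> \<in> S" "Sup S / 2 < \<rho>"
    using less_cSup_iff[of S "Sup S / 2"] s0 bdd by auto
  have "s \<notin> S" if "2 * \<rho> < s" for s
    using cSup_upper[OF _ bdd, of s] \<rho> that by auto
  then show ?thesis using \<rho>(1) \<open>0 < e\<close> unfolding S_def by fastforce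
qed

text \<open>
  The truncation \<open>e\<close> makes the claim vacuous for \<open>r \<le> e\<close>, which starts the induction on the
  scale. The superlevel set at height \<open>t = 2 * D ^ 7 * N\<close> is covered by fivefold dilates of
  disjoint stopping balls. Because their radii are nearly maximal, on each dilate the maximal
  function exceeds that of the smaller ball by at most \<open>t + D ^ 4 * N\<close>, and the total measure of
  the dilates is at most half of that of the ball, so the constants reproduce themselves.
\<close>

lemma local_max_integral_trunc:
  assumes f: "set_integrable lebesgue Q f" and N: "0 < N"
    and osc: "\<And>y s. \<lbrakk>y \<in> Q; 0 < s; s \<le> R\<rbrakk> \<Longrightarrow> mean_osc f (qball Q y s) \<le> N"
    and e: "0 < e"
  shows "\<lbrakk>x0 \<in> Q; 0 < r; 3 * r \<le> R; r \<le> e * 2 ^ k\<rbrakk> \<Longrightarrow>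
    (\<integral>\<^sup>+x\<in>qball Q x0 r. local_max Q f (avg (qball Q x0 (3 * r)) f) e r x \<partial>lebesgue)
      \<le> ennreal (7 * D ^ 7 * N) * emeasure lebesgue (qball Q x0 r)"
proof (induction k arbitrary: x0 r)
  case 0
  have "local_max Q f c e r x = 0" for c x
    using 0 local_max_least[of Q e r x f c 0] by simp
  then show ?case by simp
next
  case (Suc k)
  define B where "B = qball Q x0 r"
  define B3 where "B3 = qball Q x0 (3 * r)"
  define c where "c = avg B3 f"
  define F where "F = local_max Q f c e r"
  define t where "t = 2 * D ^ 7 * N"
  define E where "E = {x \<in> B. ennreal t < F x}"
  let ?avg = "\<lambda>y s. avg (qball Q y s) (\<lambda>z. \<bar>f z - c\<bar>)"
  note x0 = \<open>x0 \<in> Q\<close> and r = \<open>0 < r\<close> and rR = \<open>3 * r \<le> R\<close>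
  have D1: "1 \<le> D" by (rule D_ge_1)
  have t: "0 < t" unfolding t_def using N D1 by simp
  have fq: "set_integrable lebesgue (qball Q y s) f" for y s
    by (rule set_integrable_qball[OF f])
  have gq: "set_integrable lebesgue (qball Q y s) (\<lambda>z. \<bar>f z - c\<bar>)" for y s
    by (intro set_integrable_abs_diff_const qball_lmeasurable fq)
  have avgB3: "?avg x0 (3 * r) \<le> N"
    using osc[OF x0 _ rR] r unfolding mean_osc_def c_def B3_def by simp
  \<comment> \<open>This is why \<open>c\<close> is the mean over the triple ball: a ball of radius
    at most \<open>r\<close> that meets \<open>B\<close> stays inside \<open>B3\<close>.\<close>
  have sub_B3: "qball Q y s \<subseteq> B3" "dist x0 y \<le> 2 * r"
    if "x \<in> B" "x \<in> qball Q y s" "s \<le> r" for x y s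
  proof -
    have d: "dist x0 y < r + s"
      using that dist_triangle[of x0 y x] by (simp add: B_def mem_qball dist_commute)
    then show "dist x0 y \<le> 2 * r" using that by simp
    show "qball Q y s \<subseteq> B3" unfolding B3_def
      using d that by (intro qball_shift) (simp add: dist_commute)
  qed
  \<comment> \<open>A ball of radius comparable to \<open>r\<close> has measure comparable to that
    of \<open>B3\<close>. The number 5 is the distance 2 of the centres plus the radius 3, in units
    of \<open>r\<close>.\<close>
  have avg_big: "?avg y s \<le> D ^ m * N"
    if "y \<in> Q" "0 < s" "s \<le> r" "x \<in> B" "x \<in> qball Q y s" "5 * r \<le> 2 ^ m * s" for x y s m
  proof -
    have "measure lebesgue B3 \<le> D ^ m * measure lebesgue (qball Q y s)"
      unfolding B3_def using sub_B3(2)[of x y s] that by (intro measure_qball_le) auto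
    then have "?avg y s \<le> D ^ m * ?avg x0 (3 * r)"
      using sub_B3(1)[of x y s] that r x0 unfolding B3_def
      by (intro avg_subset_le qball_lmeasurable qball_pos gq) auto
    also have "\<dots> \<le> D ^ m * N" using avgB3 D1 by (intro mult_left_mono) auto
    finally show ?thesis .
  qed
  have "\<forall>x\<in>E. \<exists>y \<rho>. y \<in> Q \<and> e < \<rho> \<and> \<rho> \<le> r \<and> x \<in> qball Q y \<rho> \<and> t < ?avg y \<rho> \<and>
    (\<forall>z s. z \<in> Q \<longrightarrow> 2 * \<rho> < s \<longrightarrow> s \<le> r \<longrightarrow> x \<in> qball Q z s \<longrightarrow> ?avg z s \<le> t)"
    using t e by (intro ballI exists_near_maximal_ball) (auto simp: E_def F_def)
  then obtain a \<rho> where sel: "\<And>x. x \<in> E \<Longrightarrow> a x \<in> Q \<and> e < \<rho> x \<and> \<rho> x \<le> r \<and> x \<in> qball Q (a x) (\<rho> x) \<and> t < ?avg (a x) (\<rho> x)"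
    and max: "\<And>x z s. \<lbrakk>x \<in> E; z \<in> Q; 2 * \<rho> x < s; s \<le> r; x \<in> qball Q z s\<rbrakk> \<Longrightarrow> ?avg z s \<le> t"
    by metis
  have \<rho>_bounds: "0 < \<rho> i \<and> \<rho> i \<le> r" if "i \<in> E" for i using sel[OF that] e by simp
  obtain C where C: "countable C" "C \<subseteq> E"
    "pairwise (\<lambda>i j. disjnt (cball (a i) (\<rho> i)) (cball (a j) (\<rho> j))) C"
    and cov: "\<And>i. i \<in> E \<Longrightarrow> \<exists>j. j \<in> C \<and> \<not> disjnt (cball (a i) (\<rho> i)) (cball (a j) (\<rho> j)) \<and>
      cball (a i) (\<rho> i) \<subseteq> ball (a j) (5 * \<rho> j)"
    by (rule Vitali_covering_lemma_cballs_balls[of E \<rho> r a]) (use \<rho>_bounds in blast, rule that)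
  have E_B: "x \<in> B" if "x \<in> E" for x using that by (simp add: E_def)
  have CE: "j \<in> E" "a j \<in> Q" "e < \<rho> j" "0 < \<rho> j" "\<rho> j \<le> r" "j \<in> qball Q (a j) (\<rho> j)" "t < ?avg (a j) (\<rho> j)" "j \<in> B"
    if "j \<in> C" for j
    using sel[of j] e E_B[of j] that C(2) by auto
  \<comment> \<open>Otherwise \<open>5 * r\<close> is at most \<open>2 ^ 7 * \<rho> j\<close>, and
    the average is at most half of \<open>t\<close>. The gain is twofold: the radius
    \<open>5 * \<rho> j\<close> falls under the induction hypothesis, and
    \<open>15 * \<rho> j\<close> is still at most \<open>r\<close>, so near-maximality can be used
    at that radius.\<close>
  have small: "16 * \<rho> j < r" if "j \<in> C" for j
  proof (rule ccontr)
    assume "\<not> 16 * \<rho> j < r"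
    then have "?avg (a j) (\<rho> j) \<le> D ^ 7 * N"
      using CE[OF that] by (intro avg_big[of _ _ j]) auto
    moreover have "0 < D ^ 7 * N" using N D1 by simp
    ultimately show False using CE(7)[OF that] by (simp add: t_def)
  qed
  \<comment> \<open>The majorant of \<open>F\<close> on the fivefold dilate: the local maximal
    function belonging to that dilate, centred at its own mean, plus a constant for the recentring
    and for the larger balls.\<close>
  define G where "G j x = local_max Q f (avg (qball Q (a j) (3 * (5 * \<rho> j))) f) e (5 * \<rho> j) x + ennreal (t + D ^ 4 * N)" for j x
  have F_le_G: "F x \<le> G j x" if j: "j \<in> C" and x: "x \<in> B" "x \<in> qball Q (a j) (5 * \<rho> j)" for j x
    unfolding F_def
  proof (rule local_max_least)
    fix y s assume ys: "y \<in> Q" "0 < s" "e < s" "s \<le> r" "x \<in> qball Q y s"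
    define c' where "c' = avg (qball Q (a j) (3 * (5 * \<rho> j))) f"
    note cj = CE[OF j]
    have DN: "0 \<le> D ^ 4 * N" using N D1 by simp
    show "ennreal (?avg y s) \<le> G j x"
    proof (cases "s \<le> 5 * \<rho> j")
      case True
      have "?avg y s \<le> avg (qball Q y s) (\<lambda>z. \<bar>f z - c'\<bar>) + \<bar>c' - c\<bar>"
        using ys by (intro avg_abs_diff_const_le qball_lmeasurable qball_pos fq) auto
      also have "\<bar>c' - c\<bar> \<le> ?avg (a j) (3 * (5 * \<rho> j))"
        unfolding c'_def using cj by (intro abs_avg_diff_const_le qball_lmeasurable qball_pos fq) auto
      \<comment> \<open>The ball of radius \<open>15 * \<rho> j\<close> contains \<open>j\<close>,
        and its radius lies between \<open>2 * \<rho> j\<close> and \<open>r\<close>.\<close>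
      also have "\<dots> \<le> t"
        using cj(6) small[OF j] cj(4)
        by (intro max[of j] cj) (auto simp: mem_qball)
      finally have "ennreal (?avg y s) \<le> ennreal (avg (qball Q y s) (\<lambda>z. \<bar>f z - c'\<bar>) + (t + D ^ 4 * N))"
        using DN by (intro ennreal_leI) simp
      also have "\<dots> = ennreal (avg (qball Q y s) (\<lambda>z. \<bar>f z - c'\<bar>)) + ennreal (t + D ^ 4 * N)"
        using t DN by (intro ennreal_plus avg_nonneg) auto
      also have "\<dots> \<le> G j x"
        unfolding G_def c'_def using ys True by (intro add_right_mono local_max_upper) auto
      finally show ?thesis .
    next
      case s5: False
      \<comment> \<open>The centre \<open>y\<close> is at distance less than
        \<open>s + 5 * \<rho> j + \<rho> j < 3 * s\<close> from \<open>j\<close>, so the tripled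
        ball contains \<open>j\<close>. If its radius is at most \<open>r\<close>, near-maximality
        bounds its average by \<open>t\<close>; otherwise \<open>s\<close> is comparable to
        \<open>r\<close> and \<open>avg_big\<close> applies.\<close>
      have "?avg y s \<le> t + D ^ 4 * N"
      proof (cases "3 * s \<le> r")
        case True
        have "?avg y s \<le> D ^ 4 * mean_osc f (qball Q y (3 * s)) + ?avg y (3 * s)"
        proof (intro avg_abs_diff_subset_le qball_lmeasurable qball_pos fq qball_mono)
          show "measure lebesgue (qball Q y (3 * s)) \<le> D ^ 4 * measure lebesgue (qball Q y s)"
            using ys by (intro measure_qball_le) auto
        qed (use ys in auto)
        also have "mean_osc f (qball Q y (3 * s)) \<le> N"
          using ys True rR r by (intro osc) auto
        also have "?avg y (3 * s) \<le> t"
        proof (rule max[of j])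
          have "dist y j \<le> dist y x + dist x (a j) + dist (a j) j"
            by (metis dist_triangle add_right_mono order_trans)
          then show "j \<in> qball Q y (3 * s)"
            using cj(4,6) ys(5) x(2) s5 by (simp add: mem_qball dist_commute)
        qed (use ys True s5 cj in auto)
        finally show ?thesis using D1 by (simp add: mult_left_mono)
      next
        case False
        have "?avg y s \<le> D ^ 4 * N"
          using ys False x by (intro avg_big[of _ _ x]) auto
        then show ?thesis using t by simp
      qed
      then have "ennreal (?avg y s) \<le> ennreal (t + D ^ 4 * N)" by (rule ennreal_leI)
      then show ?thesis unfolding G_def by (simp add: add_increasing)
    qed
  qed
  have DN4: "0 \<le> D ^ 4 * N" and DN7: "0 \<le> D ^ 7 * N" using N D1 by simp_all
  \<comment> \<open>By the induction hypothesis, \<open>A\<close> bounds the mean of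
    \<open>G j\<close> over the fivefold dilate; since 5 is at most \<open>2 ^ 3\<close>, returning
    to the stopping ball costs a further \<open>D ^ 3\<close>.\<close>
  define A where "A = 7 * D ^ 7 * N + (t + D ^ 4 * N)"
  have A0: "0 \<le> A" unfolding A_def using DN4 DN7 t by simp
  define X where "X = (\<integral>\<^sup>+j. emeasure lebesgue (qball Q (a j) (\<rho> j)) \<partial>count_space C)"
  have G_int: "(\<integral>\<^sup>+x. G j x * indicator (qball Q (a j) (5 * \<rho> j)) x \<partial>lebesgue)
      \<le> ennreal (A * D ^ 3) * emeasure lebesgue (qball Q (a j) (\<rho> j))" if j: "j \<in> C" for j
  proof -
    note cj = CE[OF j]
    let ?B5 = "qball Q (a j) (5 * \<rho> j)"
    have "(\<integral>\<^sup>+x. G j x * indicator ?B5 x \<partial>lebesgue)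
      = (\<integral>\<^sup>+x\<in>?B5. local_max Q f (avg (qball Q (a j) (3 * (5 * \<rho> j))) f) e (5 * \<rho> j) x \<partial>lebesgue)
        + ennreal (t + D ^ 4 * N) * emeasure lebesgue ?B5"
      unfolding G_def by (simp add: distrib_right nn_integral_add nn_integral_cmult_indicator)
    also have "\<dots> \<le> ennreal (7 * D ^ 7 * N) * emeasure lebesgue ?B5 + ennreal (t + D ^ 4 * N) * emeasure lebesgue ?B5"
      using cj small[OF j] Suc.prems by (intro add_right_mono Suc.IH) auto
    also have "\<dots> = ennreal A * emeasure lebesgue ?B5"
      unfolding A_def using DN4 DN7 t by (subst ennreal_plus[of "7 * D ^ 7 * N"]) (auto simp only: distrib_right)
    also have "\<dots> \<le> ennreal A * (ennreal (D ^ 3) * emeasure lebesgue (qball Q (a j) (\<rho> j)))"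
      using cj by (intro mult_left_mono emeasure_qball_le) auto
    finally show ?thesis using A0 D1 by (simp add: ennreal_mult' mult.assoc)
  qed
  have disj: "disjoint_family_on (\<lambda>j. qball Q (a j) (\<rho> j)) C"
    unfolding disjoint_family_on_def
  proof (intro ballI impI)
    fix i j assume "i \<in> C" "j \<in> C" "i \<noteq> j"
    then have "disjnt (cball (a i) (\<rho> i)) (cball (a j) (\<rho> j))" using C(3) by (auto simp: pairwise_def)
    then show "qball Q (a i) (\<rho> i) \<inter> qball Q (a j) (\<rho> j) = {}"
      by (auto simp: disjnt_iff qball_def) (meson less_imp_le)
  qed
  \<comment> \<open>Chebyshev's argument: the stopping balls are disjoint, lie in \<open>B3\<close>,
    and each carries an average of \<open>\<bar>f - c\<bar>\<close> above \<open>t\<close>, while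
    the average over \<open>B3\<close> is at most \<open>N\<close>.\<close>
  have X_le: "ennreal t * X \<le> ennreal (N * D ^ 2) * emeasure lebesgue B"
  proof -
    define h where "h = (\<lambda>x. ennreal (indicator Q x *\<^sub>R \<bar>f x - c\<bar>))"
    have "set_integrable lebesgue Q (\<lambda>x. \<bar>f x - c\<bar>)"
      by (intro set_integrable_abs_diff_const Q_lmeasurable f)
    then have h[measurable]: "h \<in> borel_measurable lebesgue"
      unfolding h_def set_integrable_def by measurable
    have h_eq: "(\<integral>\<^sup>+x. h x * indicator (qball Q y s) x \<partial>lebesgue) = ennreal (?avg y s) * emeasure lebesgue (qball Q y s)"
      if "y \<in> Q" "0 < s" for y s
    proof -
      have "(\<integral>\<^sup>+x. h x * indicator (qball Q y s) x \<partial>lebesgue) = (\<integral>\<^sup>+x\<in>qball Q y s. ennreal \<bar>f x - c\<bar> \<partial>lebesgue)"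
        by (intro nn_integral_cong) (auto simp: h_def mem_qball indicator_def)
      also have "\<dots> = ennreal (?avg y s) * emeasure lebesgue (qball Q y s)"
        using that by (intro nn_set_integral_eq_avg qball_lmeasurable qball_pos gq) auto
      finally show ?thesis .
    qed
    have "ennreal t * X = (\<integral>\<^sup>+j. ennreal t * emeasure lebesgue (qball Q (a j) (\<rho> j)) \<partial>count_space C)"
      unfolding X_def by (simp add: nn_integral_cmult)
    also have "\<dots> \<le> (\<integral>\<^sup>+j. emeasure (density lebesgue h) (qball Q (a j) (\<rho> j)) \<partial>count_space C)"
    proof (rule nn_integral_mono)
      fix j assume "j \<in> space (count_space C)"
      then have j: "j \<in> C" by simp
      show "ennreal t * emeasure lebesgue (qball Q (a j) (\<rho> j)) \<le> emeasure (density lebesgue h) (qball Q (a j) (\<rho> j))"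
        using CE[OF j] by (subst emeasure_density) (auto simp: h_eq intro!: mult_right_mono ennreal_leI)
    qed
    also have "\<dots> = emeasure (density lebesgue h) (\<Union>j\<in>C. qball Q (a j) (\<rho> j))"
      by (intro emeasure_UN_countable[symmetric] disj C(1)) auto
    also have "\<dots> \<le> emeasure (density lebesgue h) B3"
    proof (rule emeasure_mono)
      show "(\<Union>j\<in>C. qball Q (a j) (\<rho> j)) \<subseteq> B3"
        by (intro UN_least sub_B3(1)[OF CE(8) CE(6) CE(5)])
    qed (simp add: B3_def)
    also have "\<dots> = ennreal (?avg x0 (3 * r)) * emeasure lebesgue B3"
      unfolding B3_def using x0 r by (subst emeasure_density) (auto simp: h_eq)
    also have "\<dots> \<le> ennreal N * (ennreal (D ^ 2) * emeasure lebesgue B)"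
      unfolding B3_def B_def using avgB3 x0 r by (intro mult_mono emeasure_qball_le ennreal_leI) auto
    finally show ?thesis using N by (simp add: ennreal_mult' mult.assoc)
  qed
  have B_meas: "emeasure lebesgue B = ennreal (measure lebesgue B)"
    unfolding B_def by (rule emeasure_eq_measure2[OF qball_lmeasurable])
  \<comment> \<open>The bound on \<open>X\<close> makes \<open>2 * D ^ 5 * X\<close> at most the
    measure of \<open>B\<close>, and \<open>A\<close> is at most
    \<open>(7 + 2 + 1) * D ^ 7 * N\<close>. The stopping balls thus contribute
    \<open>5 * D ^ 7 * N\<close> times the measure of \<open>B\<close>, and adding \<open>t\<close>
    restores the constant 7.\<close>
  have X_le': "ennreal (A * D ^ 3) * X \<le> ennreal (5 * D ^ 7 * N) * emeasure lebesgue B"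
  proof -
    have tX: "ennreal t * X \<le> ennreal (N * D ^ 2 * measure lebesgue B)"
      using X_le N D1 by (simp add: B_meas ennreal_mult')
    have "X \<noteq> top" using tX t by (auto simp: ennreal_mult_top top_unique)
    then obtain z where z: "X = ennreal z" "0 \<le> z" by (cases X) auto
    have "t * z \<le> N * D ^ 2 * measure lebesgue B"
      using tX t z N by (simp add: ennreal_mult[symmetric] ennreal_le_iff)
    then have "D ^ 2 * N * (2 * D ^ 5 * z) \<le> D ^ 2 * N * measure lebesgue B"
      by (simp add: t_def power2_eq_square numeral_eq_Suc algebra_simps)
    then have zD: "2 * D ^ 5 * z \<le> measure lebesgue B"
      using N D1 by (subst (asm) mult_le_cancel_left_pos) auto
    have "D ^ 4 \<le> D ^ 7" "D ^ 3 \<le> D ^ 5" using D1 by (auto intro: power_increasing)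
    have "A \<le> 10 * D ^ 7 * N"
      unfolding A_def t_def using \<open>D ^ 4 \<le> D ^ 7\<close> N mult_right_mono[of "D^4" "D^7" N] by simp
    then have "A * D ^ 3 * z \<le> 10 * D ^ 7 * N * D ^ 5 * z"
      using \<open>D ^ 3 \<le> D ^ 5\<close> z D1 A0 N by (intro mult_mono mult_nonneg_nonneg) auto
    also have "\<dots> = 5 * D ^ 7 * N * (2 * D ^ 5 * z)" by simp
    also have "\<dots> \<le> 5 * D ^ 7 * N * measure lebesgue B"
      using zD N D1 by (intro mult_left_mono) auto
    finally have "ennreal (A * D ^ 3 * z) \<le> ennreal (5 * D ^ 7 * N * measure lebesgue B)"
      by (rule ennreal_leI)
    then show ?thesis using A0 D1 z N by (simp add: B_meas ennreal_mult)
  qed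
  have "(\<integral>\<^sup>+x\<in>B. F x \<partial>lebesgue)
    \<le> (\<integral>\<^sup>+x. ennreal t * indicator B x + (\<integral>\<^sup>+j. G j x * indicator (qball Q (a j) (5 * \<rho> j)) x \<partial>count_space C) \<partial>lebesgue)"
  proof (rule nn_integral_mono)
    fix x
    \<comment> \<open>Outside \<open>E\<close> the value is at most \<open>t\<close>. A point of
      \<open>E\<close> lies in at least one dilate, and a single term is bounded by the whole
      sum.\<close>
    show "F x * indicator B x \<le> ennreal t * indicator B x + (\<integral>\<^sup>+j. G j x * indicator (qball Q (a j) (5 * \<rho> j)) x \<partial>count_space C)"
    proof (cases "x \<in> E")
      case True
      then obtain j where j: "j \<in> C" "cball (a x) (\<rho> x) \<subseteq> ball (a j) (5 * \<rho> j)" using cov by blast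
      have xj: "x \<in> qball Q (a j) (5 * \<rho> j)"
        using sel[OF True] subsetD[OF j(2), of x] by (auto simp: qball_def)
      then have "F x * indicator B x \<le> G j x * indicator (qball Q (a j) (5 * \<rho> j)) x"
        using F_le_G[OF j(1) E_B[OF True] xj] E_B[OF True] by simp
      also have "\<dots> \<le> (\<integral>\<^sup>+j. G j x * indicator (qball Q (a j) (5 * \<rho> j)) x \<partial>count_space C)"
        by (rule nn_integral_ge_point[OF j(1)])
      finally show ?thesis by (simp add: add_increasing)
    next
      case False
      then have "F x * indicator B x \<le> ennreal t * indicator B x"
        by (auto simp: E_def indicator_def not_less)
      then show ?thesis by (simp add: add_increasing2)
    qed
  qed
  also have "\<dots> = ennreal t * emeasure lebesgue B
      + (\<integral>\<^sup>+x. (\<integral>\<^sup>+j. G j x * indicator (qball Q (a j) (5 * \<rho> j)) x \<partial>count_space C) \<partial>lebesgue)"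
  proof (subst nn_integral_add)
    show "(\<lambda>x. \<integral>\<^sup>+j. G j x * indicator (qball Q (a j) (5 * \<rho> j)) x \<partial>count_space C) \<in> borel_measurable lebesgue"
      unfolding G_def using C(1) by (intro borel_measurable_nn_integral_count_space) auto
  qed (auto simp: B_def nn_integral_cmult_indicator)
  also have "(\<integral>\<^sup>+x. (\<integral>\<^sup>+j. G j x * indicator (qball Q (a j) (5 * \<rho> j)) x \<partial>count_space C) \<partial>lebesgue)
      = (\<integral>\<^sup>+j. \<integral>\<^sup>+x. G j x * indicator (qball Q (a j) (5 * \<rho> j)) x \<partial>lebesgue \<partial>count_space C)"
    unfolding G_def using C(1) by (intro nn_integral_count_space_nn_integral) auto
  also have "\<dots> \<le> (\<integral>\<^sup>+j. ennreal (A * D ^ 3) * emeasure lebesgue (qball Q (a j) (\<rho> j)) \<partial>count_space C)"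
    by (intro nn_integral_mono G_int) simp
  also have "\<dots> = ennreal (A * D ^ 3) * X"
    unfolding X_def by (simp add: nn_integral_cmult)
  also have "\<dots> \<le> ennreal (5 * D ^ 7 * N) * emeasure lebesgue B" by (rule X_le')
  also have "ennreal t * emeasure lebesgue B + \<dots> = ennreal (t + 5 * D ^ 7 * N) * emeasure lebesgue B"
    using t DN7 by (subst ennreal_plus[of t]) (auto simp only: distrib_right)
  also have "t + 5 * D ^ 7 * N = 7 * D ^ 7 * N" by (simp add: t_def)
  finally show ?case
    by (simp add: F_def B_def c_def B3_def add_left_mono)
qed

text \<open>The truncated bound does not depend on \<open>e\<close>, so monotone convergence along
  \<open>e = 1 / (i + 1)\<close> removes the cut-off. That bound asks for a positive
  \<open>N\<close>; the value 0, as for constant \<open>f\<close>, is reached by applying it to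
  \<open>N' > N\<close> and letting \<open>N'\<close> decrease to \<open>N\<close>.\<close>

lemma local_max_integral_le:
  assumes f: "set_integrable lebesgue Q f" and N: "0 \<le> N"
    and osc: "\<And>y s. \<lbrakk>y \<in> Q; 0 < s; s \<le> R\<rbrakk> \<Longrightarrow> mean_osc f (qball Q y s) \<le> N"
    and x0: "x0 \<in> Q" and r: "0 < r" "3 * r \<le> R"
  shows "(\<integral>\<^sup>+x\<in>qball Q x0 r. local_max Q f (avg (qball Q x0 (3 * r)) f) 0 r x \<partial>lebesgue)
      \<le> ennreal (7 * D ^ 7 * N) * emeasure lebesgue (qball Q x0 r)"
proof -
  define c where "c = avg (qball Q x0 (3 * r)) f"
  let ?B = "qball Q x0 r"
  let ?e = "\<lambda>i::nat. 1 / real (Suc i)"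
  have trunc: "(\<integral>\<^sup>+x\<in>?B. local_max Q f c (?e i) r x \<partial>lebesgue) \<le> ennreal (7 * D ^ 7 * N) * emeasure lebesgue ?B" for i
  proof -
    have "(\<integral>\<^sup>+x\<in>?B. local_max Q f c (?e i) r x \<partial>lebesgue) \<le> ennreal (7 * D ^ 7 * N' * measure lebesgue ?B)" if N': "N < N'" for N'
    proof -
      obtain k where "r / ?e i < 2 ^ k" using real_arch_pow[of 2] by auto
      then have "r \<le> ?e i * 2 ^ k" by (simp add: field_simps)
      then have "(\<integral>\<^sup>+x\<in>?B. local_max Q f c (?e i) r x \<partial>lebesgue) \<le> ennreal (7 * D ^ 7 * N') * emeasure lebesgue ?B"
        unfolding c_def using N' N osc
        by (intro local_max_integral_trunc[OF f _ _ _ x0 r]) (auto intro: order_trans[OF _ less_imp_le[OF N']])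
      then show ?thesis using N N' D_ge_1 by (simp add: emeasure_eq_measure2[OF qball_lmeasurable] ennreal_mult')
    qed
    then have "\<forall>\<^sub>F N' in at_right N. (\<integral>\<^sup>+x\<in>?B. local_max Q f c (?e i) r x \<partial>lebesgue) \<le> ennreal (7 * D ^ 7 * N' * measure lebesgue ?B)"
      by (auto simp: eventually_at_right_less intro: eventually_mono[OF eventually_at_right_less])
    moreover have "((\<lambda>N'. ennreal (7 * D ^ 7 * N' * measure lebesgue ?B)) \<longlongrightarrow> ennreal (7 * D ^ 7 * N * measure lebesgue ?B)) (at_right N)"
      by (intro tendsto_intros)
    ultimately have "(\<integral>\<^sup>+x\<in>?B. local_max Q f c (?e i) r x \<partial>lebesgue) \<le> ennreal (7 * D ^ 7 * N * measure lebesgue ?B)"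
      by (intro tendsto_lowerbound[where F = "at_right N"]) auto
    then show ?thesis using N D_ge_1 by (simp add: emeasure_eq_measure2[OF qball_lmeasurable] ennreal_mult')
  qed
  have mono: "local_max Q f c (?e i) r x \<le> local_max Q f c (?e j) r x" if "i \<le> j" for i j x
  proof (intro local_max_least local_max_upper)
    fix s :: real
    assume "?e i < s"
    moreover have "?e j \<le> ?e i" using that by (intro divide_left_mono) auto
    ultimately show "?e j < s" by simp
  qed
  have "local_max Q f c 0 r x \<le> (SUP i. local_max Q f c (?e i) r x)" for x
  proof (rule local_max_least)
    fix y s assume ys: "y \<in> Q" "0 < s" "s \<le> r" "x \<in> qball Q y s"
    obtain i where "?e i < s" using reals_Archimedean[OF ys(2)] by (auto simp: inverse_eq_divide)
    then show "ennreal (avg (qball Q y s) (\<lambda>z. \<bar>f z - c\<bar>)) \<le> (SUP i. local_max Q f c (?e i) r x)"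
      using ys by (intro SUP_upper2[of i] local_max_upper) auto
  qed
  then have "(\<integral>\<^sup>+x\<in>?B. local_max Q f c 0 r x \<partial>lebesgue) \<le> (\<integral>\<^sup>+x. (SUP i. local_max Q f c (?e i) r x * indicator ?B x) \<partial>lebesgue)"
    by (intro nn_integral_mono) (auto simp: indicator_def)
  also have "\<dots> = (SUP i. \<integral>\<^sup>+x. local_max Q f c (?e i) r x * indicator ?B x \<partial>lebesgue)"
    using mono by (intro nn_integral_monotone_convergence_SUP) (auto simp: incseq_def le_fun_def intro!: mult_right_mono)
  also have "\<dots> \<le> ennreal (7 * D ^ 7 * N) * emeasure lebesgue ?B"
    by (intro SUP_least trunc)
  finally show ?thesis by (simp add: c_def)
qed

end

section \<open>The fractional maximal function\<close>

lemma AE_in_positive_set_exists: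
  assumes "B \<in> lmeasurable" "0 < measure lebesgue B" "AE x in lebesgue. x \<in> B \<longrightarrow> P x"
  shows "\<exists>x\<in>B. P x"
proof (rule ccontr)
  assume "\<not> (\<exists>x\<in>B. P x)"
  then have "AE x in lebesgue. x \<notin> B" using assms(3) by (auto elim: eventually_mono)
  then have "emeasure lebesgue B = 0"
    using assms(1) AE_iff_null_sets[of B lebesgue] by (auto simp: fmeasurable_def null_sets_def)
  then show False using assms(2) by (simp add: measure_def)
qed

lemma set_integrable_real_rep:
  assumes "B \<in> sets M" "G \<in> borel_measurable M" "(\<integral>\<^sup>+x\<in>B. G x \<partial>M) < \<infinity>"
  shows "set_integrable M B (real_rep G)"
  unfolding set_integrable_def real_rep_def
proof (rule integrableI_bounded)
  have [measurable]: "G \<in> borel_measurable M" "B \<in> sets M" by fact+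
  show "(\<lambda>x. indicat_real B x *\<^sub>R enn2real (G x)) \<in> borel_measurable M" by measurable
  have "(\<integral>\<^sup>+x. ennreal (norm (indicat_real B x *\<^sub>R enn2real (G x))) \<partial>M) \<le> (\<integral>\<^sup>+x\<in>B. G x \<partial>M)"
    by (intro nn_integral_mono) (auto simp: indicator_def ennreal_enn2real_if)
  also have "\<dots> < \<infinity>" by fact
  finally show "(\<integral>\<^sup>+x. ennreal (norm (indicat_real B x *\<^sub>R enn2real (G x))) \<partial>M) < \<infinity>" .
qed

text \<open>The hypothesis \<open>le\<close> holds for every pair of points, so an infimum over
  \<open>z\<close> gives \<open>G x \<le> H x + m\<close> with a finite constant \<open>m\<close>.
  This constant is at most the essential infimum, so the mean of \<open>H\<close> controls the mean
  above it; the mean oscillation is at most twice the mean distance to \<open>m\<close>.\<close>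

lemma real_rep_oscillation_bounds:
  fixes G :: "'a::euclidean_space \<Rightarrow> ennreal"
  assumes B: "B \<in> lmeasurable" "0 < measure lebesgue B"
    and G: "G \<in> borel_measurable lebesgue" and fin: "(\<integral>\<^sup>+x\<in>B. G x \<partial>lebesgue) < \<infinity>"
    and le: "\<And>x z. x \<in> B \<Longrightarrow> z \<in> B \<Longrightarrow> G x \<le> H x + G z"
    and K: "(\<integral>\<^sup>+x\<in>B. H x \<partial>lebesgue) \<le> ennreal K * emeasure lebesgue B" "0 \<le> K"
  shows "mean_above_inf (real_rep G) B \<le> ennreal K" "mean_osc (real_rep G) B \<le> 2 * K"
proof -
  note [measurable] = G
  have B_sets [measurable]: "B \<in> sets lebesgue" using B by (auto simp: fmeasurable_def)
  have Bpos: "0 < emeasure lebesgue B" using B by (simp add: emeasure_eq_measure2)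
  have "AE x in lebesgue. G x * indicator B x \<noteq> \<infinity>"
    using fin by (intro nn_integral_PInf_AE) auto
  then have AE_fin: "AE x in lebesgue. x \<in> B \<longrightarrow> G x < top"
    by (auto elim!: eventually_mono simp: less_top)
  obtain z0 where z0: "z0 \<in> B" "G z0 < top"
    using AE_in_positive_set_exists[OF B AE_fin] by blast
  define m where "m = (INF z\<in>B. G z)"
  have m_top: "m < top" unfolding m_def using z0 by (intro INF_less_iff[THEN iffD2]) auto
  define \<mu> where "\<mu> = enn2real m"
  have m_eq: "m = ennreal \<mu>" and \<mu>0: "0 \<le> \<mu>" using m_top by (auto simp: \<mu>_def)
  have le_m: "G x \<le> H x + m" if "x \<in> B" for x
  proof (cases "H x = top")
    case False
    have "G x - H x \<le> m" unfolding m_def using le that False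
      by (intro INF_greatest) (auto simp: ennreal_minus_le_iff)
    then show ?thesis using False by (simp add: ennreal_minus_le_iff)
  qed simp
  let ?g = "real_rep G"
  have g_meas [measurable]: "?g \<in> borel_measurable lebesgue" unfolding real_rep_def[abs_def] by measurable
  \<comment> \<open>This holds only almost everywhere: \<open>real_rep\<close> is 0 where
    \<open>G\<close> is infinite, which may be below \<open>\<mu>\<close>. The essential infimum
    ignores such points.\<close>
  have AE_ge: "AE x in lebesgue. x \<in> B \<longrightarrow> \<mu> \<le> ?g x"
    using AE_fin
  proof (rule eventually_mono, intro impI)
    fix x assume "x \<in> B \<longrightarrow> G x < top" "x \<in> B"
    moreover have "m \<le> G x" using \<open>x \<in> B\<close> unfolding m_def by (rule INF_lower)
    ultimately show "\<mu> \<le> ?g x" unfolding \<mu>_def real_rep_def by (intro enn2real_mono) auto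
  qed
  have AE_le: "AE x in lebesgue. x \<in> B \<longrightarrow> ennreal (?g x - \<mu>) \<le> H x"
    using AE_fin
  proof (rule eventually_mono, intro impI)
    fix x assume x: "x \<in> B \<longrightarrow> G x < top" "x \<in> B"
    then have "ennreal (?g x) \<le> H x + ennreal \<mu>"
      using le_m[OF x(2)] by (simp add: real_rep_def m_eq)
    then have "ennreal (?g x) - ennreal \<mu> \<le> H x"
      by (simp add: ennreal_minus_le_iff add.commute)
    then show "ennreal (?g x - \<mu>) \<le> H x" using \<mu>0 by (simp add: ennreal_minus)
  qed
  have int_le: "(\<integral>\<^sup>+x\<in>B. ennreal (?g x - \<mu>) \<partial>lebesgue) \<le> ennreal K * emeasure lebesgue B"
    using AE_le by (intro order_trans[OF nn_integral_mono_AE K(1)]) (auto elim!: eventually_mono simp: indicator_def)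
  have ess: "ereal \<mu> \<le> ess_inf B ?g"
  proof -
    have "esssup (lebesgue_on B) (\<lambda>y. - ereal (?g y)) \<le> - ereal \<mu>"
    proof (rule esssup_I)
      show "(\<lambda>y. - ereal (?g y)) \<in> borel_measurable (lebesgue_on B)"
        by (intro measurable_restrict_space1) measurable
      show "AE x in lebesgue_on B. - ereal (?g x) \<le> - ereal \<mu>"
        using AE_ge by (subst AE_restrict_space_iff) (auto elim!: eventually_mono)
    qed
    then have "- (- ereal \<mu>) \<le> - esssup (lebesgue_on B) (\<lambda>y. - ereal (?g y))"
      by (subst ereal_minus_le_minus)
    then show ?thesis unfolding ess_inf_def by simp
  qed
  have "(\<integral>\<^sup>+y\<in>B. e2ennreal (ereal (?g y) - ess_inf B ?g) \<partial>lebesgue) \<le> (\<integral>\<^sup>+y\<in>B. ennreal (?g y - \<mu>) \<partial>lebesgue)"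
  proof (intro nn_integral_mono mult_right_mono)
    fix y
    have "ereal (?g y) - ess_inf B ?g \<le> ereal (?g y) - ereal \<mu>"
      by (intro ereal_minus_mono ess) auto
    then show "e2ennreal (ereal (?g y) - ess_inf B ?g) \<le> ennreal (?g y - \<mu>)"
      using e2ennreal_mono by fastforce
  qed auto
  then show "mean_above_inf ?g B \<le> ennreal K"
    unfolding mean_above_inf_def using int_le Bpos
    by (intro divide_le_posI_ennreal) (auto simp: mult.commute)
  have g_int: "set_integrable lebesgue B ?g"
    by (rule set_integrable_real_rep[OF B_sets G fin])
  have "ennreal (avg B (\<lambda>y. \<bar>?g y - \<mu>\<bar>)) * emeasure lebesgue B = (\<integral>\<^sup>+y\<in>B. ennreal \<bar>?g y - \<mu>\<bar> \<partial>lebesgue)"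
    by (intro nn_set_integral_eq_avg[symmetric] B set_integrable_abs_diff_const g_int) auto
  also have "\<dots> = (\<integral>\<^sup>+x\<in>B. ennreal (?g x - \<mu>) \<partial>lebesgue)"
    using AE_ge by (intro nn_integral_cong_AE) (auto elim!: eventually_mono simp: indicator_def)
  also note int_le
  finally have "ennreal (avg B (\<lambda>y. \<bar>?g y - \<mu>\<bar>) * measure lebesgue B) \<le> ennreal (K * measure lebesgue B)"
    using B K by (simp add: emeasure_eq_measure2 ennreal_mult'')
  then have "avg B (\<lambda>y. \<bar>?g y - \<mu>\<bar>) \<le> K"
    using B K by (simp add: ennreal_le_iff)
  then show "mean_osc ?g B \<le> 2 * K"
    using mean_osc_le_twice[OF B g_int, of \<mu>] by simp
qed

context doubling_domain
begin

lemma frac_max_upper: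
  assumes "y \<in> Q" "0 < s" "s < 2 * diameter Q" "x \<in> qball Q y s"
  shows "ennreal (s powr \<alpha> * avg (qball Q y s) (\<lambda>z. \<bar>f z\<bar>)) \<le> frac_max \<alpha> Q f x"
  unfolding frac_max_def using assms by (intro SUP_upper2[of "(y, s)"]) (auto simp: qballs_def)

lemma frac_max_least:
  assumes "\<And>y s. \<lbrakk>y \<in> Q; 0 < s; s < 2 * diameter Q; x \<in> qball Q y s\<rbrakk> \<Longrightarrow>
    ennreal (s powr \<alpha> * avg (qball Q y s) (\<lambda>z. \<bar>f z\<bar>)) \<le> t"
  shows "frac_max \<alpha> Q f x \<le> t"
  unfolding frac_max_def using assms by (intro SUP_least) (auto simp: qballs_def)

lemma borel_measurable_frac_max [measurable]: "frac_max \<alpha> Q f \<in> borel_measurable lebesgue"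
proof -
  have "frac_max \<alpha> Q f = (\<lambda>x. SUP b\<in>{b\<in>{(y, r) \<in> qballs Q. r < 2 * diameter Q}. x \<in> qball Q (fst b) (snd b)}.
      ennreal (snd b powr \<alpha> * avg (qball Q (fst b) (snd b)) (\<lambda>z. \<bar>f z\<bar>)))"
    unfolding frac_max_def by (intro ext SUP_cong) auto
  also have "\<dots> \<in> borel_measurable lebesgue" by (rule borel_measurable_SUP_qball) auto
  finally show ?thesis .
qed

lemma avg_abs_nonneg: "0 \<le> avg B (\<lambda>z. \<bar>f z :: real\<bar>)"
  by (rule avg_nonneg) simp

text \<open>A ball of radius at least \<open>2 * diameter Q\<close> is not admissible in the supremum, but the
  same set is the ball of an admissible radius larger than \<open>s\<close>.\<close>

lemma frac_max_ge:
  assumes \<alpha>: "0 \<le> \<alpha>" and "y \<in> Q" "0 < s" "s < 2 * diameter Q" "s \<le> t" "z \<in> qball Q y t"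
  shows "ennreal (s powr \<alpha> * avg (qball Q y t) (\<lambda>z. \<bar>f z\<bar>)) \<le> frac_max \<alpha> Q f z"
proof -
  obtain u where u: "s \<le> u" "u < 2 * diameter Q" "qball Q y u = qball Q y t"
  proof (cases "t < 2 * diameter Q")
    case True
    then show ?thesis using that[of t] assms by auto
  next
    case False
    define u where "u = max s ((3 / 2) * diameter Q)"
    have "qball Q y u = Q" "qball Q y t = Q"
      using False Q_diameter_pos assms by (auto intro!: qball_eq_Q simp: u_def)
    then show ?thesis using that[of u] Q_diameter_pos assms by (auto simp: u_def)
  qed
  have "ennreal (s powr \<alpha> * avg (qball Q y t) (\<lambda>z. \<bar>f z\<bar>)) \<le> ennreal (u powr \<alpha> * avg (qball Q y u) (\<lambda>z. \<bar>f z\<bar>))"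
    using u assms by (intro ennreal_leI) (auto intro!: mult_right_mono powr_mono2 avg_abs_nonneg)
  also have "\<dots> \<le> frac_max \<alpha> Q f z"
    using u assms by (intro frac_max_upper) auto
  finally show ?thesis .
qed

text \<open>For \<open>s \<le> r\<close> the function is split as \<open>f - c\<close> plus
  \<open>c\<close>. On the first part the weight is replaced by its largest value; on the constant
  it stays \<open>s powr \<alpha>\<close>, because that term must be compared with the maximal
  function at another point.\<close>

lemma frac_max_le_local_max:
  assumes \<alpha>: "0 \<le> \<alpha>" and f: "set_integrable lebesgue Q f"
    and large: "\<And>y s. \<lbrakk>y \<in> Q; 0 < s; r < s; s < 2 * diameter Q; x \<in> qball Q y s\<rbrakk> \<Longrightarrow>
      ennreal (s powr \<alpha> * avg (qball Q y s) (\<lambda>z. \<bar>f z\<bar>)) \<le> t"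
    and const: "\<And>s. \<lbrakk>0 < s; s \<le> r; s < 2 * diameter Q\<rbrakk> \<Longrightarrow> ennreal (s powr \<alpha> * \<bar>c\<bar>) \<le> t"
  shows "frac_max \<alpha> Q f x \<le> ennreal ((2 * diameter Q) powr \<alpha>) * local_max Q f c 0 r x + t"
proof (rule frac_max_least)
  fix y s assume ys: "y \<in> Q" "0 < s" "s < 2 * diameter Q" "x \<in> qball Q y s"
  let ?W = "(2 * diameter Q) powr \<alpha>"
  show "ennreal (s powr \<alpha> * avg (qball Q y s) (\<lambda>z. \<bar>f z\<bar>)) \<le> ennreal ?W * local_max Q f c 0 r x + t"
  proof (cases "s \<le> r")
    case True
    let ?a = "avg (qball Q y s) (\<lambda>z. \<bar>f z - c\<bar>)"
    have "avg (qball Q y s) (\<lambda>z. \<bar>f z - 0\<bar>) \<le> ?a + \<bar>c - 0\<bar>"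
      using ys by (intro avg_abs_diff_const_le qball_lmeasurable qball_pos set_integrable_qball[OF f])
    then have "avg (qball Q y s) (\<lambda>z. \<bar>f z\<bar>) \<le> ?a + \<bar>c\<bar>" by simp
    then have "s powr \<alpha> * avg (qball Q y s) (\<lambda>z. \<bar>f z\<bar>) \<le> s powr \<alpha> * (?a + \<bar>c\<bar>)"
      by (intro mult_left_mono) auto
    also have "\<dots> \<le> ?W * ?a + s powr \<alpha> * \<bar>c\<bar>"
      using ys \<alpha> by (simp add: distrib_left avg_nonneg mult_right_mono powr_mono2)
    finally have "ennreal (s powr \<alpha> * avg (qball Q y s) (\<lambda>z. \<bar>f z\<bar>)) \<le> ennreal ?W * ennreal ?a + ennreal (s powr \<alpha> * \<bar>c\<bar>)"
      by (simp add: ennreal_plus[symmetric] ennreal_mult[symmetric] avg_nonneg ennreal_leI del: ennreal_plus)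
    also have "\<dots> \<le> ennreal ?W * local_max Q f c 0 r x + t"
      using ys True by (intro add_mono mult_left_mono local_max_upper const) auto
    finally show ?thesis .
  next
    case False
    then show ?thesis using large[of y s] ys by (simp add: add_increasing)
  qed
qed

text \<open>Splitting at radius \<open>2 * diameter Q\<close> leaves no large balls, and the ball of
  that radius is \<open>Q\<close>, so the local estimate on this single ball suffices.\<close>

lemma nn_integral_frac_max_finite:
  assumes \<alpha>: "0 \<le> \<alpha>" and f: "set_integrable lebesgue Q f" and N: "0 \<le> N"
    and osc: "\<And>y s. \<lbrakk>y \<in> Q; 0 < s\<rbrakk> \<Longrightarrow> mean_osc f (qball Q y s) \<le> N"
  shows "(\<integral>\<^sup>+x\<in>Q. frac_max \<alpha> Q f x \<partial>lebesgue) < \<infinity>"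
proof -
  obtain x0 where x0: "x0 \<in> Q" using Q_nonempty by auto
  let ?d = "2 * diameter Q" and ?W = "(2 * diameter Q) powr \<alpha>"
  have d: "0 < ?d" "diameter Q < ?d" using Q_diameter_pos by auto
  define c where "c = avg (qball Q x0 (3 * ?d)) f"
  have Q: "qball Q x0 ?d = Q" by (rule qball_eq_Q[OF x0 d(2)])
  have Qm [measurable]: "Q \<in> sets lebesgue" using qball_sets[of x0 ?d] Q by simp
  have Q_fin: "emeasure lebesgue Q < top" using Q_lmeasurable by (simp add: fmeasurable_def)
  have lm: "(\<integral>\<^sup>+x\<in>Q. local_max Q f c 0 ?d x \<partial>lebesgue) \<le> ennreal (7 * D ^ 7 * N) * emeasure lebesgue Q"
    using local_max_integral_le[OF f N, of "3 * ?d" x0 ?d] x0 d osc unfolding c_def by (simp add: Q)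
  have "frac_max \<alpha> Q f x \<le> ennreal ?W * local_max Q f c 0 ?d x + ennreal (?W * \<bar>c\<bar>)" for x
    using \<alpha> by (intro frac_max_le_local_max f) (auto intro!: ennreal_leI mult_right_mono powr_mono2)
  then have "(\<integral>\<^sup>+x\<in>Q. frac_max \<alpha> Q f x \<partial>lebesgue)
      \<le> (\<integral>\<^sup>+x. ennreal ?W * (local_max Q f c 0 ?d x * indicator Q x) + ennreal (?W * \<bar>c\<bar>) * indicator Q x \<partial>lebesgue)"
    by (intro nn_integral_mono) (auto simp: indicator_def)
  also have "\<dots> = ennreal ?W * (\<integral>\<^sup>+x\<in>Q. local_max Q f c 0 ?d x \<partial>lebesgue) + ennreal (?W * \<bar>c\<bar>) * emeasure lebesgue Q"
    by (simp add: nn_integral_add nn_integral_cmult nn_integral_cmult_indicator)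
  also have "\<dots> \<le> ennreal ?W * (ennreal (7 * D ^ 7 * N) * emeasure lebesgue Q) + ennreal (?W * \<bar>c\<bar>) * emeasure lebesgue Q"
    by (intro add_right_mono mult_left_mono lm) auto
  also have "\<dots> < \<infinity>" using Q_fin by (simp add: ennreal_mult_less_top)
  finally show ?thesis .
qed

text \<open>The hypothesis \<open>large\<close> isolates the radii above \<open>r\<close>, which BMO
  and VMO treat differently. Combined with the local estimate it gives the two-point inequality
  required by \<open>real_rep_oscillation_bounds\<close>.\<close>

lemma frac_max_oscillation_bounds:
  assumes \<alpha>: "0 \<le> \<alpha>" and f: "set_integrable lebesgue Q f" and N: "0 \<le> N"
    and osc: "\<And>y s. \<lbrakk>y \<in> Q; 0 < s; s \<le> 3 * r\<rbrakk> \<Longrightarrow> mean_osc f (qball Q y s) \<le> N"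
    and fin: "(\<integral>\<^sup>+x\<in>Q. frac_max \<alpha> Q f x \<partial>lebesgue) < \<infinity>"
    and x0: "x0 \<in> Q" and r: "0 < r"
    and \<eta>: "0 \<le> \<eta>"
    and large: "\<And>x y z s. \<lbrakk>y \<in> Q; 0 < s; r < s; s < 2 * diameter Q; x \<in> qball Q y s;
        x \<in> qball Q x0 r; z \<in> qball Q x0 r\<rbrakk> \<Longrightarrow>
      ennreal (s powr \<alpha> * avg (qball Q y s) (\<lambda>z. \<bar>f z\<bar>)) \<le> ennreal \<eta> + frac_max \<alpha> Q f z"
  defines "K \<equiv> (2 * diameter Q) powr \<alpha> * (7 * D ^ 7 * N) + \<eta>"
  shows "mean_above_inf (real_rep (frac_max \<alpha> Q f)) (qball Q x0 r) \<le> ennreal K"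
    and "mean_osc (real_rep (frac_max \<alpha> Q f)) (qball Q x0 r) \<le> 2 * K"
proof -
  let ?W = "(2 * diameter Q) powr \<alpha>"
  let ?B = "qball Q x0 r"
  define c where "c = avg (qball Q x0 (3 * r)) f"
  define H where "H x = ennreal ?W * local_max Q f c 0 r x + ennreal \<eta>" for x
  have K0: "0 \<le> K" using N D_ge_1 \<eta> by (simp add: K_def)
  have fin_B: "(\<integral>\<^sup>+x\<in>?B. frac_max \<alpha> Q f x \<partial>lebesgue) < \<infinity>"
    by (rule le_less_trans[OF nn_integral_mono fin]) (auto simp: indicator_def mem_qball)
  have le: "frac_max \<alpha> Q f x \<le> H x + frac_max \<alpha> Q f z" if "x \<in> ?B" "z \<in> ?B" for x z
    unfolding H_def add.assoc
  proof (rule frac_max_le_local_max[OF \<alpha> f])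
    \<comment> \<open>The modulus of \<open>c\<close> is at most the average of
      \<open>\<bar>f\<bar>\<close> over the triple ball, which contains \<open>z\<close>. Its radius
      is at least \<open>s\<close>, so \<open>frac_max_ge\<close> applies with the weight
      \<open>s powr \<alpha>\<close>, even if \<open>3 * r\<close> is inadmissible.\<close>
    fix s assume s: "0 < s" "s \<le> r" "s < 2 * diameter Q"
    have z3: "z \<in> qball Q x0 (3 * r)" using that r by (auto simp: mem_qball)
    have "\<bar>c\<bar> \<le> avg (qball Q x0 (3 * r)) (\<lambda>z. \<bar>f z\<bar>)" unfolding c_def by (rule abs_avg_le)
    then have "ennreal (s powr \<alpha> * \<bar>c\<bar>) \<le> ennreal (s powr \<alpha> * avg (qball Q x0 (3 * r)) (\<lambda>z. \<bar>f z\<bar>))"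
      by (intro ennreal_leI mult_left_mono) auto
    also have "\<dots> \<le> frac_max \<alpha> Q f z"
      using s z3 x0 by (intro frac_max_ge \<alpha>) auto
    finally show "ennreal (s powr \<alpha> * \<bar>c\<bar>) \<le> ennreal \<eta> + frac_max \<alpha> Q f z"
      by (simp add: add_increasing)
  qed (use large that in auto)
  have lm: "(\<integral>\<^sup>+x\<in>?B. local_max Q f c 0 r x \<partial>lebesgue) \<le> ennreal (7 * D ^ 7 * N) * emeasure lebesgue ?B"
    unfolding c_def using osc by (intro local_max_integral_le[OF f N _ x0 r]) auto
  have "(\<integral>\<^sup>+x\<in>?B. H x \<partial>lebesgue)
      = (\<integral>\<^sup>+x. ennreal ?W * (local_max Q f c 0 r x * indicator ?B x) + ennreal \<eta> * indicator ?B x \<partial>lebesgue)"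
    unfolding H_def by (intro nn_integral_cong) (auto simp: indicator_def)
  also have "\<dots> = ennreal ?W * (\<integral>\<^sup>+x\<in>?B. local_max Q f c 0 r x \<partial>lebesgue) + ennreal \<eta> * emeasure lebesgue ?B"
    by (simp add: nn_integral_add nn_integral_cmult nn_integral_cmult_indicator)
  also have "\<dots> \<le> ennreal ?W * (ennreal (7 * D ^ 7 * N) * emeasure lebesgue ?B) + ennreal \<eta> * emeasure lebesgue ?B"
    by (intro add_right_mono mult_left_mono lm) auto
  also have "\<dots> = ennreal K * emeasure lebesgue ?B"
    using N D_ge_1 \<eta> unfolding K_def
    by (simp add: emeasure_eq_measure2[OF qball_lmeasurable] ennreal_mult[symmetric] ennreal_plus[symmetric] algebra_simps del: ennreal_plus)
  finally have H_int: "(\<integral>\<^sup>+x\<in>?B. H x \<partial>lebesgue) \<le> ennreal K * emeasure lebesgue ?B" .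
  show "mean_above_inf (real_rep (frac_max \<alpha> Q f)) ?B \<le> ennreal K"
    by (rule real_rep_oscillation_bounds(1)[OF qball_lmeasurable qball_pos[OF x0 r] borel_measurable_frac_max fin_B le H_int K0])
  show "mean_osc (real_rep (frac_max \<alpha> Q f)) ?B \<le> 2 * K"
    by (rule real_rep_oscillation_bounds(2)[OF qball_lmeasurable qball_pos[OF x0 r] borel_measurable_frac_max fin_B le H_int K0])
qed

lemma mem_enlarged_qball:
  assumes "x \<in> qball Q y s" "x \<in> qball Q x0 r" "z \<in> qball Q x0 r"
  shows "z \<in> qball Q y (s + 2 * r)"
  using assms dist_triangle[of y z x] dist_triangle[of x z x0] by (simp add: mem_qball dist_commute)

text \<open>As \<open>r < s\<close>, the enlarged radius is below \<open>4 * s\<close>, whence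
  \<open>D ^ 2\<close>. Keeping the weight \<open>s powr \<alpha>\<close> lets
  \<open>frac_max_ge\<close> cover an enlarged radius that is no longer admissible.\<close>

lemma large_ball_le_frac_max:
  assumes \<alpha>: "0 \<le> \<alpha>" and f: "set_integrable lebesgue Q f" and N: "0 \<le> N"
    and osc: "mean_osc f (qball Q y (s + 2 * r)) \<le> N"
    and y: "y \<in> Q" "0 < r" "r < s" "s < 2 * diameter Q" and z: "z \<in> qball Q y (s + 2 * r)"
  shows "ennreal (s powr \<alpha> * avg (qball Q y s) (\<lambda>z. \<bar>f z\<bar>))
    \<le> ennreal ((2 * diameter Q) powr \<alpha> * (D ^ 2 * N)) + frac_max \<alpha> Q f z"
proof -
  let ?W = "(2 * diameter Q) powr \<alpha>"
  let ?a = "avg (qball Q y (s + 2 * r)) (\<lambda>z. \<bar>f z\<bar>)"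
  have "avg (qball Q y s) (\<lambda>z. \<bar>f z - 0\<bar>)
      \<le> D ^ 2 * mean_osc f (qball Q y (s + 2 * r)) + avg (qball Q y (s + 2 * r)) (\<lambda>z. \<bar>f z - 0\<bar>)"
    using y by (intro avg_abs_diff_subset_le qball_lmeasurable qball_pos qball_mono measure_qball_le set_integrable_qball f) auto
  also have "D ^ 2 * mean_osc f (qball Q y (s + 2 * r)) \<le> D ^ 2 * N"
    using osc D_ge_1 by (intro mult_left_mono) auto
  finally have "s powr \<alpha> * avg (qball Q y s) (\<lambda>z. \<bar>f z\<bar>) \<le> s powr \<alpha> * (D ^ 2 * N + ?a)"
    by (intro mult_left_mono) auto
  also have "\<dots> \<le> ?W * (D ^ 2 * N) + s powr \<alpha> * ?a"
    using y \<alpha> N by (simp add: distrib_left mult_right_mono powr_mono2)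
  finally have "ennreal (s powr \<alpha> * avg (qball Q y s) (\<lambda>z. \<bar>f z\<bar>)) \<le> ennreal (?W * (D ^ 2 * N)) + ennreal (s powr \<alpha> * ?a)"
    using N by (simp add: ennreal_plus[symmetric] avg_nonneg ennreal_leI del: ennreal_plus)
  also have "\<dots> \<le> ennreal (?W * (D ^ 2 * N)) + frac_max \<alpha> Q f z"
    using y z by (intro add_left_mono frac_max_ge \<alpha>) auto
  finally show ?thesis .
qed

section \<open>BLO and BMO bounds for \<open>f\<close> in BMO\<close>

lemma mean_osc_le_bmo:
  assumes "f \<in> BMO Q" "y \<in> Q" "0 < s"
  shows "mean_osc f (qball Q y s) \<le> enn2real (bmo_norm Q f)"
proof -
  have "ennreal (mean_osc f (qball Q y s)) \<le> bmo_norm Q f"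
    unfolding bmo_norm_def using assms by (intro SUP_upper2[of "(y, s)"]) (auto simp: qballs_def)
  moreover have "bmo_norm Q f < top" using assms by (simp add: BMO_def)
  ultimately show ?thesis
    by (metis enn2real_ennreal enn2real_mono mean_osc_nonneg)
qed

lemma BMO_imp_nn_integral_frac_max_finite:
  assumes "0 \<le> \<alpha>" "f \<in> BMO Q"
  shows "(\<integral>\<^sup>+x\<in>Q. frac_max \<alpha> Q f x \<partial>lebesgue) < \<infinity>"
  using assms mean_osc_le_bmo[OF assms(2)]
  by (intro nn_integral_frac_max_finite[of _ _ "enn2real (bmo_norm Q f)"]) (auto simp: BMO_def loc_integrable_iff)

lemma BMO_imp_frac_max_finite_AE:
  assumes "0 \<le> \<alpha>" "f \<in> BMO Q"
  shows "AE x in lebesgue_on Q. frac_max \<alpha> Q f x < \<infinity>"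
proof -
  have Qm [measurable]: "Q \<in> sets lebesgue" using Q_lmeasurable by (auto simp: fmeasurable_def)
  have "AE x in lebesgue. frac_max \<alpha> Q f x * indicator Q x \<noteq> \<infinity>"
    using BMO_imp_nn_integral_frac_max_finite[OF assms] by (intro nn_integral_PInf_AE) auto
  then show ?thesis
    by (subst AE_restrict_space_iff) (auto elim!: eventually_mono simp: less_top)
qed

lemma BMO_imp_loc_integrable_frac_max:
  assumes "0 \<le> \<alpha>" "f \<in> BMO Q"
  shows "loc_integrable Q (real_rep (frac_max \<alpha> Q f))"
  using BMO_imp_nn_integral_frac_max_finite[OF assms] Q_lmeasurable
  by (auto simp: loc_integrable_iff fmeasurable_def intro!: set_integrable_real_rep)

lemma BMO_frac_max_oscillation_bounds:
  assumes \<alpha>: "0 \<le> \<alpha>" and f: "f \<in> BMO Q" and x0: "x0 \<in> Q" and r: "0 < r"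
  defines "K \<equiv> (2 * diameter Q) powr \<alpha> * (7 * D ^ 7 + D ^ 2) * enn2real (bmo_norm Q f)"
  shows "mean_above_inf (real_rep (frac_max \<alpha> Q f)) (qball Q x0 r) \<le> ennreal K"
    and "mean_osc (real_rep (frac_max \<alpha> Q f)) (qball Q x0 r) \<le> 2 * K"
proof -
  let ?N = "enn2real (bmo_norm Q f)" and ?W = "(2 * diameter Q) powr \<alpha>"
  have f': "set_integrable lebesgue Q f" using f by (simp add: BMO_def loc_integrable_iff)
  have K: "K = ?W * (7 * D ^ 7 * ?N) + ?W * (D ^ 2 * ?N)" by (simp add: K_def algebra_simps)
  have large: "ennreal (s powr \<alpha> * avg (qball Q y s) (\<lambda>z. \<bar>f z\<bar>)) \<le> ennreal (?W * (D ^ 2 * ?N)) + frac_max \<alpha> Q f z"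
    if "y \<in> Q" "0 < s" "r < s" "s < 2 * diameter Q" "x \<in> qball Q y s" "x \<in> qball Q x0 r" "z \<in> qball Q x0 r" for x y z s
    using that r by (intro large_ball_le_frac_max \<alpha> f' mean_osc_le_bmo f mem_enlarged_qball) auto
  have \<eta>: "0 \<le> ?W * (D ^ 2 * ?N)" by simp
  show "mean_above_inf (real_rep (frac_max \<alpha> Q f)) (qball Q x0 r) \<le> ennreal K"
    unfolding K
    by (rule frac_max_oscillation_bounds(1)[OF \<alpha> f' _ _ BMO_imp_nn_integral_frac_max_finite[OF \<alpha> f] x0 r \<eta>])
      (use large mean_osc_le_bmo[OF f] in auto)
  show "mean_osc (real_rep (frac_max \<alpha> Q f)) (qball Q x0 r) \<le> 2 * K"
    unfolding K
    by (rule frac_max_oscillation_bounds(2)[OF \<alpha> f' _ _ BMO_imp_nn_integral_frac_max_finite[OF \<alpha> f] x0 r \<eta>])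
      (use large mean_osc_le_bmo[OF f] in auto)
qed

lemma frac_max_BLO:
  assumes \<alpha>: "0 \<le> \<alpha>" and f: "f \<in> BMO Q"
  defines "C \<equiv> (2 * diameter Q) powr \<alpha> * (7 * D ^ 7 + D ^ 2)"
  shows "real_rep (frac_max \<alpha> Q f) \<in> BLO Q"
    and "blo_norm Q (real_rep (frac_max \<alpha> Q f)) \<le> ennreal C * bmo_norm Q f"
proof -
  have fin: "bmo_norm Q f < top" using f by (simp add: BMO_def)
  have C: "0 \<le> C" using D_ge_1 by (simp add: C_def)
  have "blo_norm Q (real_rep (frac_max \<alpha> Q f)) \<le> ennreal (C * enn2real (bmo_norm Q f))"
    unfolding blo_norm_def C_def
    by (intro SUP_least) (auto simp: qballs_def intro: BMO_frac_max_oscillation_bounds(1)[OF \<alpha> f])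
  also have "\<dots> = ennreal C * bmo_norm Q f"
    using fin C by (simp add: ennreal_mult)
  finally show le: "blo_norm Q (real_rep (frac_max \<alpha> Q f)) \<le> ennreal C * bmo_norm Q f" .
  also have "\<dots> < top" using fin by (simp add: ennreal_mult_less_top)
  finally show "real_rep (frac_max \<alpha> Q f) \<in> BLO Q"
    unfolding BLO_def using BMO_imp_loc_integrable_frac_max[OF \<alpha> f] by simp
qed

lemma frac_max_BMO:
  assumes \<alpha>: "0 \<le> \<alpha>" and f: "f \<in> BMO Q"
  shows "real_rep (frac_max \<alpha> Q f) \<in> BMO Q"
proof -
  define K where "K = (2 * diameter Q) powr \<alpha> * (7 * D ^ 7 + D ^ 2) * enn2real (bmo_norm Q f)"
  have "bmo_norm Q (real_rep (frac_max \<alpha> Q f)) \<le> ennreal (2 * K)"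
    unfolding bmo_norm_def using BMO_frac_max_oscillation_bounds(2)[OF \<alpha> f, folded K_def]
    by (intro SUP_least) (auto simp: qballs_def intro!: ennreal_leI)
  then have "bmo_norm Q (real_rep (frac_max \<alpha> Q f)) < \<infinity>"
    by (simp add: less_top[symmetric] top_unique) (metis ennreal_neq_top top.extremum_unique)
  then show ?thesis
    unfolding BMO_def using BMO_imp_loc_integrable_frac_max[OF \<alpha> f] by simp
qed

section \<open>Preservation of VMO\<close>

lemma VMO_iff:
  "f \<in> VMO Q \<longleftrightarrow> f \<in> BMO Q \<and>
    (\<forall>\<epsilon>>0. \<exists>\<delta>>0. \<forall>x\<in>Q. \<forall>s. 0 < s \<longrightarrow> s \<le> \<delta> \<longrightarrow> mean_osc f (qball Q x s) \<le> \<epsilon>)"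
proof -
  define S where "S r = (SUP (x, s) \<in> {(x, s) \<in> qballs Q. s \<le> r}. ennreal (mean_osc f (qball Q x s)))" for r
  have S_upper: "ennreal (mean_osc f (qball Q x s)) \<le> S r" if "x \<in> Q" "0 < s" "s \<le> r" for x s r
    unfolding S_def using that by (intro SUP_upper2[of "(x, s)"]) (auto simp: qballs_def)
  have S_least: "S r \<le> t" if "\<And>x s. x \<in> Q \<Longrightarrow> 0 < s \<Longrightarrow> s \<le> r \<Longrightarrow> ennreal (mean_osc f (qball Q x s)) \<le> t" for r t
    unfolding S_def using that by (intro SUP_least) (auto simp: qballs_def)
  have "(S \<longlongrightarrow> 0) (at_right 0) \<longleftrightarrow>
    (\<forall>\<epsilon>>0. \<exists>\<delta>>0. \<forall>x\<in>Q. \<forall>s. 0 < s \<longrightarrow> s \<le> \<delta> \<longrightarrow> mean_osc f (qball Q x s) \<le> \<epsilon>)"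
    (is "?L \<longleftrightarrow> ?R")
  proof
    assume L: ?L
    show ?R
    proof (intro allI impI)
      fix \<epsilon> :: real assume \<epsilon>: "0 < \<epsilon>"
      then have "\<forall>\<^sub>F r in at_right 0. S r < ennreal \<epsilon>"
        using order_tendstoD(2)[OF L, of "ennreal \<epsilon>"] by simp
      then obtain b where b: "0 < b" "\<And>r. 0 < r \<Longrightarrow> r < b \<Longrightarrow> S r < ennreal \<epsilon>"
        by (auto simp: eventually_at_right_field)
      have "mean_osc f (qball Q x s) \<le> \<epsilon>" if "x \<in> Q" "0 < s" "s \<le> b / 2" for x s
      proof -
        have "ennreal (mean_osc f (qball Q x s)) \<le> S (b / 2)" using that by (rule S_upper)
        also have "\<dots> < ennreal \<epsilon>" using b by auto
        finally show ?thesis using \<epsilon> by (simp add: ennreal_less_iff mean_osc_nonneg)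
      qed
      then show "\<exists>\<delta>>0. \<forall>x\<in>Q. \<forall>s. 0 < s \<longrightarrow> s \<le> \<delta> \<longrightarrow> mean_osc f (qball Q x s) \<le> \<epsilon>"
        using b(1) by (intro exI[of _ "b / 2"]) auto
    qed
  next
    assume R: ?R
    show ?L
    proof (rule order_tendstoI)
      fix a :: ennreal assume "0 < a"
      then obtain b where "0 < b" "b < a" using dense by blast
      then obtain \<epsilon> where \<epsilon>: "0 < \<epsilon>" "ennreal \<epsilon> < a"
        by (cases b) (auto simp: less_top[symmetric] ennreal_less_zero_iff dest: less_trans)
      obtain \<delta> where \<delta>: "0 < \<delta>" "\<And>x s. x \<in> Q \<Longrightarrow> 0 < s \<Longrightarrow> s \<le> \<delta> \<Longrightarrow> mean_osc f (qball Q x s) \<le> \<epsilon>"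
        using R \<epsilon>(1) by meson
      have "S r < a" if "r < \<delta>" for r
        using that \<delta>(2) by (intro le_less_trans[OF S_least \<epsilon>(2)] ennreal_leI) auto
      then show "\<forall>\<^sub>F r in at_right 0. S r < a"
        unfolding eventually_at_right_field using \<delta>(1) by blast
    qed simp
  qed
  then show ?thesis unfolding VMO_def S_def[abs_def] by simp
qed

text \<open>Intersecting with \<open>Q\<close> only shrinks the annulus, so its Euclidean volume is
  a bound uniform in the centre.\<close>

lemma measure_qball_diff_le:
  assumes "0 \<le> s" "s \<le> t"
  shows "measure lebesgue (qball Q y t) - measure lebesgue (qball Q y s)
    \<le> unit_ball_vol (DIM('a)) * (t ^ DIM('a) - s ^ DIM('a))"
proof -
  have "measure lebesgue (qball Q y t) - measure lebesgue (qball Q y s) = measure lebesgue (qball Q y t - qball Q y s)"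
    using assms by (intro measurable_measure_Diff[symmetric] qball_lmeasurable qball_mono qball_sets) auto
  also have "\<dots> \<le> measure lebesgue (ball y t - ball y s)"
  proof (rule measure_mono_fmeasurable)
    show "qball Q y t - qball Q y s \<in> sets lebesgue" by (intro sets.Diff qball_sets)
  qed (auto simp: qball_def)
  also have "\<dots> = measure lebesgue (ball y t) - measure lebesgue (ball y s)"
    using assms by (intro measurable_measure_Diff) auto
  also have "\<dots> = unit_ball_vol (DIM('a)) * (t ^ DIM('a) - s ^ DIM('a))"
    using assms by (simp add: content_ball algebra_simps)
  finally show ?thesis .
qed

text \<open>A fixed number of doublings turns radius \<open>\<delta>\<close> into one beyond the
  diameter, where the ball is all of \<open>Q\<close>.\<close>

lemma measure_qball_lower_bound:
  assumes "0 < \<delta>"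
  obtains v where "0 < v" "\<And>y s. y \<in> Q \<Longrightarrow> \<delta> \<le> s \<Longrightarrow> v \<le> measure lebesgue (qball Q y s)"
proof -
  obtain k where "diameter Q / \<delta> < 2 ^ k" using real_arch_pow[of 2] by auto
  then have k: "diameter Q < 2 ^ k * \<delta>" using assms by (simp add: field_simps)
  have "measure lebesgue Q / D ^ k \<le> measure lebesgue (qball Q y s)" if "y \<in> Q" "\<delta> \<le> s" for y s
  proof -
    have "diameter Q < 2 ^ k * s" using k that(2) by (smt (verit) mult_left_mono zero_le_power)
    then have "measure lebesgue Q \<le> D ^ k * measure lebesgue (qball Q y s)"
      using doubling_power[of y s k] that assms by (simp add: qball_eq_Q)
    then show ?thesis using D_ge_1 by (simp add: field_simps)
  qed
  moreover have "0 < measure lebesgue Q / D ^ k" using measure_Q_pos D_ge_1 by simp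
  ultimately show ?thesis using that by blast
qed

text \<open>Balls of radius bounded below change by a set of uniformly small measure under a small
  enlargement, so here no control of the oscillation is needed.\<close>

lemma avg_enlarged_qball_uniform:
  assumes f: "set_integrable lebesgue Q f" and "0 < \<delta>" "0 < \<eta>"
  obtains r0 where "0 < r0" "\<And>y s r. \<lbrakk>y \<in> Q; \<delta> \<le> s; s \<le> 2 * diameter Q; 0 < r; r \<le> r0\<rbrakk> \<Longrightarrow>
    avg (qball Q y s) (\<lambda>z. \<bar>f z\<bar>) \<le> avg (qball Q y (s + 2 * r)) (\<lambda>z. \<bar>f z\<bar>) + \<eta>"
proof -
  obtain v where v: "0 < v" "\<And>y s. y \<in> Q \<Longrightarrow> \<delta> \<le> s \<Longrightarrow> v \<le> measure lebesgue (qball Q y s)"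
    using measure_qball_lower_bound[OF \<open>0 < \<delta>\<close>] by blast
  let ?n = "DIM('a)" and ?d = "2 * diameter Q"
  define I where "I = (LINT z:Q|lebesgue. \<bar>f z\<bar>)"
  define V where "V = unit_ball_vol (real ?n)"
  have I0: "0 \<le> I" unfolding I_def set_lebesgue_integral_def
    by (intro Bochner_Integration.integral_nonneg) (auto simp: indicator_def)
  have V0: "0 < V" unfolding V_def by simp
  \<comment> \<open>Chosen to make \<open>(I + 1) * (V * \<kappa>) / (v * v)\<close> equal to
    \<open>\<eta>\<close>; the summand 1 keeps the denominator positive when
    \<open>I = 0\<close>.\<close>
  define \<kappa> where "\<kappa> = \<eta> * v\<^sup>2 / ((I + 1) * V)"
  have \<kappa>: "0 < \<kappa>" unfolding \<kappa>_def using v(1) I0 V0 \<open>0 < \<eta>\<close> by simp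
  have "uniformly_continuous_on {0..?d + 2} (\<lambda>x::real. x ^ ?n)"
    by (intro compact_uniformly_continuous continuous_intros) auto
  then obtain \<beta> where \<beta>: "0 < \<beta>" "\<And>x x'. \<lbrakk>x \<in> {0..?d + 2}; x' \<in> {0..?d + 2}; dist x' x < \<beta>\<rbrakk> \<Longrightarrow> dist (x' ^ ?n) (x ^ ?n) < \<kappa>"
    unfolding uniformly_continuous_on_def using \<kappa> by meson
  \<comment> \<open>The bound 1 keeps \<open>s + 2 * r\<close> in the interval of uniform
    continuity, and \<open>\<beta> / 4\<close> keeps the increment \<open>2 * r\<close> below
    \<open>\<beta>\<close>.\<close>
  define r0 where "r0 = min 1 (\<beta> / 4)"
  have "avg (qball Q y s) (\<lambda>z. \<bar>f z\<bar>) \<le> avg (qball Q y (s + 2 * r)) (\<lambda>z. \<bar>f z\<bar>) + \<eta>"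
    if y: "y \<in> Q" and s: "\<delta> \<le> s" "s \<le> ?d" and r: "0 < r" "r \<le> r0" for y s r
  proof -
    define J J' where "J = (LINT z:qball Q y s|lebesgue. \<bar>f z\<bar>)" and "J' = (LINT z:qball Q y (s + 2 * r)|lebesgue. \<bar>f z\<bar>)"
    define b b' where "b = measure lebesgue (qball Q y s)" and "b' = measure lebesgue (qball Q y (s + 2 * r))"
    have vb: "v \<le> b" "v \<le> b'" unfolding b_def b'_def using y s r by (auto intro!: v(2))
    have absf: "set_integrable lebesgue Q (\<lambda>z. \<bar>f z\<bar>)" using f by (rule set_integrable_abs)
    have J: "J \<le> J'" unfolding J_def J'_def using r
      by (intro set_integral_mono_set_nonneg qball_mono set_integrable_qball absf) auto
    have JI: "J \<le> I" unfolding J_def I_def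
      by (intro set_integral_mono_set_nonneg absf) (auto simp: mem_qball)
    have J0: "0 \<le> J" unfolding J_def set_lebesgue_integral_def
      by (intro Bochner_Integration.integral_nonneg) (auto simp: indicator_def)
    have "dist ((s + 2 * r) ^ ?n) (s ^ ?n) < \<kappa>"
      using s r \<open>0 < \<delta>\<close> by (intro \<beta>(2)) (auto simp: r0_def dist_real_def)
    then have "(s + 2 * r) ^ ?n - s ^ ?n \<le> \<kappa>" by (simp add: dist_real_def)
    then have "V * ((s + 2 * r) ^ ?n - s ^ ?n) \<le> V * \<kappa>" using V0 by (intro mult_left_mono) auto
    moreover have "b' - b \<le> V * ((s + 2 * r) ^ ?n - s ^ ?n)"
      unfolding b_def b'_def V_def using s r \<open>0 < \<delta>\<close> by (intro measure_qball_diff_le) auto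
    ultimately have bb: "b' - b \<le> V * \<kappa>" by linarith
    have "b \<le> b'" unfolding b_def b'_def using r by (intro measure_qball_mono qball_mono) auto
    \<comment> \<open>Since \<open>J \<le> J'\<close>, only the growth of the denominator remains to
      be estimated.\<close>
    have "J / b - J' / b' \<le> J / b - J / b'" using J vb v(1) by (simp add: divide_right_mono)
    also have "\<dots> = J * (b' - b) / (b * b')" using vb v(1) by (simp add: field_simps)
    also have "\<dots> \<le> (I + 1) * (V * \<kappa>) / (v * v)"
      using vb v(1) J0 JI bb \<open>b \<le> b'\<close> I0 V0 \<kappa> by (intro frac_le mult_mono mult_nonneg_nonneg) auto
    also have "\<dots> = \<eta>" unfolding \<kappa>_def using v(1) I0 V0 by (simp add: power2_eq_square)
    finally show ?thesis unfolding avg_def J_def J'_def b_def b'_def by simp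
  qed
  moreover have "0 < r0" using \<beta>(1) by (simp add: r0_def)
  ultimately show ?thesis using that by blast
qed

lemma frac_max_VMO:
  assumes \<alpha>: "0 \<le> \<alpha>" and f: "f \<in> VMO Q"
  shows "real_rep (frac_max \<alpha> Q f) \<in> VMO Q"
  unfolding VMO_iff
proof (intro conjI allI impI)
  have fB: "f \<in> BMO Q" using f by (simp add: VMO_def)
  then have f': "set_integrable lebesgue Q f" by (simp add: BMO_def loc_integrable_iff)
  show "real_rep (frac_max \<alpha> Q f) \<in> BMO Q" by (rule frac_max_BMO[OF \<alpha> fB])
  fix \<epsilon> :: real assume \<epsilon>: "0 < \<epsilon>"
  define W where "W = (2 * diameter Q) powr \<alpha>"
  define K where "K = W * (7 * D ^ 7 + D ^ 2)"
  have W: "0 < W" using Q_diameter_pos by (simp add: W_def)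
  have K: "0 < K" unfolding K_def using W D_ge_1 by (intro mult_pos_pos add_pos_pos) auto
  \<comment> \<open>The final bound is \<open>2 * (K * N + \<epsilon> / 4)\<close>, so
    \<open>K * N\<close> should be \<open>\<epsilon> / 4\<close>. Likewise \<open>\<eta>\<close>
    below is chosen so that \<open>W * \<eta> = \<epsilon> / 4\<close>.\<close>
  define N where "N = \<epsilon> / (4 * K)"
  have N: "0 < N" using \<epsilon> K by (simp add: N_def)
  have "\<exists>\<delta>>0. \<forall>x\<in>Q. \<forall>s. 0 < s \<longrightarrow> s \<le> \<delta> \<longrightarrow> mean_osc f (qball Q x s) \<le> N"
    using f N unfolding VMO_iff by blast
  then obtain \<delta> where \<delta>: "0 < \<delta>" "\<And>x s. \<lbrakk>x \<in> Q; 0 < s; s \<le> \<delta>\<rbrakk> \<Longrightarrow> mean_osc f (qball Q x s) \<le> N"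
    by blast
  define \<eta> where "\<eta> = \<epsilon> / (4 * W)"
  have \<eta>: "0 < \<eta>" using \<epsilon> W by (simp add: \<eta>_def)
  obtain r0 where r0: "0 < r0" "\<And>y s r. \<lbrakk>y \<in> Q; \<delta> / 2 \<le> s; s \<le> 2 * diameter Q; 0 < r; r \<le> r0\<rbrakk> \<Longrightarrow>
    avg (qball Q y s) (\<lambda>z. \<bar>f z\<bar>) \<le> avg (qball Q y (s + 2 * r)) (\<lambda>z. \<bar>f z\<bar>) + \<eta>"
    using avg_enlarged_qball_uniform[OF f' _ \<eta>, of "\<delta> / 2"] \<delta>(1) by auto
  \<comment> \<open>When \<open>s + 2 * r\<close> is at most \<open>\<delta>\<close> the error is
    the first summand, otherwise the second; their sum serves both cases.\<close>
  define \<theta> where "\<theta> = W * (D ^ 2 * N) + \<epsilon> / 4"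
  have \<theta>: "0 \<le> \<theta>" "W * (D ^ 2 * N) \<le> \<theta>" "\<epsilon> / 4 \<le> \<theta>" unfolding \<theta>_def using W N \<epsilon> by auto
  \<comment> \<open>The bound \<open>\<delta> / 4\<close> keeps \<open>3 * r\<close> below
    \<open>\<delta>\<close>. It also forces \<open>s > \<delta> / 2\<close> whenever
    \<open>s + 2 * r\<close> exceeds \<open>\<delta>\<close>, which is where \<open>r0\<close>
    controls the averages.\<close>
  have "mean_osc (real_rep (frac_max \<alpha> Q f)) (qball Q x0 r) \<le> \<epsilon>"
    if x0: "x0 \<in> Q" and r: "0 < r" "r \<le> min r0 (\<delta> / 4)" for x0 r
  proof -
    have "mean_osc (real_rep (frac_max \<alpha> Q f)) (qball Q x0 r) \<le> 2 * ((2 * diameter Q) powr \<alpha> * (7 * D ^ 7 * N) + \<theta>)"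
    proof (rule frac_max_oscillation_bounds(2)[OF \<alpha> f' _ _ BMO_imp_nn_integral_frac_max_finite[OF \<alpha> fB] x0 r(1) \<theta>(1)])
      show "mean_osc f (qball Q y s) \<le> N" if "y \<in> Q" "0 < s" "s \<le> 3 * r" for y s
        using that r \<delta>(1) by (intro \<delta>(2)) auto
      fix x y z s
      assume ys: "y \<in> Q" "0 < s" "r < s" "s < 2 * diameter Q" "x \<in> qball Q y s" "x \<in> qball Q x0 r" "z \<in> qball Q x0 r"
      have z: "z \<in> qball Q y (s + 2 * r)" using ys by (intro mem_enlarged_qball[of x]) auto
      show "ennreal (s powr \<alpha> * avg (qball Q y s) (\<lambda>z. \<bar>f z\<bar>)) \<le> ennreal \<theta> + frac_max \<alpha> Q f z"
      proof (cases "s + 2 * r \<le> \<delta>")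
        case True
        have "ennreal (s powr \<alpha> * avg (qball Q y s) (\<lambda>z. \<bar>f z\<bar>)) \<le> ennreal (W * (D ^ 2 * N)) + frac_max \<alpha> Q f z"
          unfolding W_def using ys z N r True by (intro large_ball_le_frac_max \<alpha> f' \<delta>(2)) auto
        also have "\<dots> \<le> ennreal \<theta> + frac_max \<alpha> Q f z"
          by (intro add_right_mono ennreal_leI \<theta>)
        finally show ?thesis .
      next
        case False
        let ?a = "avg (qball Q y (s + 2 * r)) (\<lambda>z. \<bar>f z\<bar>)"
        have "s powr \<alpha> * avg (qball Q y s) (\<lambda>z. \<bar>f z\<bar>) \<le> s powr \<alpha> * (?a + \<eta>)"
          using ys r False by (intro mult_left_mono r0(2)) auto
        also have "\<dots> \<le> W * \<eta> + s powr \<alpha> * ?a"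
          using ys \<alpha> \<eta> unfolding W_def by (simp add: distrib_left mult_right_mono powr_mono2)
        also have "W * \<eta> = \<epsilon> / 4" using W by (simp add: \<eta>_def)
        finally have "s powr \<alpha> * avg (qball Q y s) (\<lambda>z. \<bar>f z\<bar>) \<le> \<theta> + s powr \<alpha> * ?a"
          using \<theta>(3) by linarith
        then have "ennreal (s powr \<alpha> * avg (qball Q y s) (\<lambda>z. \<bar>f z\<bar>)) \<le> ennreal \<theta> + ennreal (s powr \<alpha> * ?a)"
          using \<theta>(1) by (simp add: ennreal_plus[symmetric] avg_nonneg ennreal_leI del: ennreal_plus)
        also have "\<dots> \<le> ennreal \<theta> + frac_max \<alpha> Q f z"
          using ys r z by (intro add_left_mono frac_max_ge \<alpha>) auto
        finally show ?thesis .
      qed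
    qed (use N in auto)
    also have "\<dots> = 2 * (K * N + \<epsilon> / 4)" by (simp add: K_def W_def \<theta>_def algebra_simps)
    also have "\<dots> = \<epsilon>" using K by (simp add: N_def)
    finally show ?thesis .
  qed
  then show "\<exists>\<delta>>0. \<forall>x\<in>Q. \<forall>s. 0 < s \<longrightarrow> s \<le> \<delta> \<longrightarrow> mean_osc (real_rep (frac_max \<alpha> Q f)) (qball Q x s) \<le> \<epsilon>"
    using r0(1) \<delta>(1) by (intro exI[of _ "min r0 (\<delta> / 4)"]) auto
qed

end

section \<open>Cubes are doubling domains\<close>

lemma content_cube:
  fixes u :: "real ^ 'n"
  assumes "0 \<le> t"
  shows "measure lebesgue (cbox u (\<chi> i. u $ i + t)) = t ^ CARD('n)"
    and "measure lebesgue (box u (\<chi> i. u $ i + t)) = t ^ CARD('n)"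
proof -
  show "measure lebesgue (cbox u (\<chi> i. u $ i + t)) = t ^ CARD('n)"
    using assms by (simp add: content_cbox_cart interval_ne_empty_cart)
  then show "measure lebesgue (box u (\<chi> i. u $ i + t)) = t ^ CARD('n)"
    by (simp add: measure_lborel_box_eq measure_lborel_cbox_eq)
qed

text \<open>Near any point, corners included, a cube of side comparable to the radius fits into the
  ball; conversely the doubled ball lies in a cube of side \<open>4 * r\<close>. Capping both sides
  by \<open>l\<close> makes the comparison valid at all scales.\<close>

lemma is_cube_doubling_domain:
  fixes Q :: "(real ^ 'n) set"
  assumes "is_cube Q"
  shows "doubling_domain Q ((8 * real CARD('n)) ^ CARD('n))"
proof -
  let ?n = "CARD('n)"
  obtain a :: "real ^ 'n" and l I where l: "0 < l"
    and I: "\<And>i. {a $ i <..< a $ i + l} \<subseteq> I i" "\<And>i. I i \<subseteq> {a $ i .. a $ i + l}"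
    and Q: "Q = {x. \<forall>i. x $ i \<in> I i}"
    using assms unfolding is_cube_def by blast
  define b :: "real ^ 'n" where "b = (\<chi> i. a $ i + l)"
  have Q_sub: "Q \<subseteq> cbox a b"
    using I(2) unfolding Q by (auto simp: mem_box_cart b_def subset_eq)
  have Q_sup: "box a b \<subseteq> Q"
    using I(1) unfolding Q by (auto simp: mem_box_cart b_def subset_eq)
  have bdd: "bounded Q" using Q_sub bounded_cbox bounded_subset by blast
  \<comment> \<open>The faces are null, so \<open>Q\<close> is measurable whatever part of them it
    contains.\<close>
  have "negligible (cbox a b - box a b)" by (rule negligible_frontier_interval)
  then have "negligible (Q - box a b)" by (rule negligible_subset) (use Q_sub in auto)
  then have "Q - box a b \<in> lmeasurable" by (rule negligible_imp_measurable)
  then have "box a b \<union> (Q - box a b) \<in> lmeasurable" by (intro fmeasurable.Un) auto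
  moreover have "box a b \<union> (Q - box a b) = Q" using Q_sup by auto
  ultimately have meas: "Q \<in> lmeasurable" by simp
  have n: "1 \<le> real ?n" by (simp add: Suc_leI)
  have qmeas: "qball Q x r \<in> lmeasurable" for x r
    unfolding qball_def by (intro fmeasurable.Int meas) simp
  have lower: "(min (r / ?n) l / 2) ^ ?n \<le> measure lebesgue (qball Q x r)" if x: "x \<in> Q" and r: "0 < r" for x r
  proof -
    define t where "t = min (r / ?n) l / 2"
    have "0 < min p l / 2 \<and> min p l / 2 \<le> l / 2 \<and> min p l / 2 < p" if "0 < p" for p
      using that l by (auto simp: min_def)
    from this[of "r / ?n"] have t: "0 < t" "t \<le> l / 2" "t < r / ?n"
      unfolding t_def using r n by simp_all
    \<comment> \<open>In each coordinate the interval of length \<open>t\<close> has an endpoint at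
      \<open>x\<close> and points away from the nearer face, so \<open>t \<le> l / 2\<close> keeps
      it inside the cube. The condition \<open>t < r / ?n\<close> makes the l1 distance from
      \<open>x\<close>, hence the Euclidean one, less than \<open>r\<close>.\<close>
    define u :: "real ^ 'n" where "u = (\<chi> i. if x $ i \<le> a $ i + l / 2 then x $ i else x $ i - t)"
    have xa: "a $ i \<le> x $ i" "x $ i \<le> a $ i + l" for i
      using x Q_sub by (auto simp: mem_box_cart b_def subset_eq)
    have "box u (\<chi> i. u $ i + t) \<subseteq> qball Q x r"
    proof
      fix y assume "y \<in> box u (\<chi> i. u $ i + t)"
      then have y: "u $ i < y $ i" "y $ i < u $ i + t" for i by (auto simp: mem_box_cart)
      have "y \<in> box a b"
        unfolding mem_box_cart b_def using y xa t by (auto simp: u_def split: if_splits) (smt (verit) field_sum_of_halves)+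
      moreover have "norm (y - x) < r"
      proof -
        have "\<bar>(y - x) $ i\<bar> < r / ?n" for i
          using y[of i] t by (auto simp: u_def split: if_splits)
        then have "(\<Sum>i\<in>UNIV. \<bar>(y - x) $ i\<bar>) < (\<Sum>i\<in>(UNIV :: 'n set). r / ?n)"
          by (intro sum_strict_mono) auto
        then show ?thesis using norm_le_l1_cart[of "y - x"] by simp
      qed
      ultimately show "y \<in> qball Q x r" using Q_sup by (auto simp: qball_def dist_norm norm_minus_commute)
    qed
    then have "measure lebesgue (box u (\<chi> i. u $ i + t)) \<le> measure lebesgue (qball Q x r)"
      by (intro measure_mono_fmeasurable qmeas) auto
    then show ?thesis
      using content_cube(2)[of t u] t by (simp add: t_def)
  qed
  have upper: "measure lebesgue (qball Q x (2 * r)) \<le> (min (4 * r) l) ^ ?n" if r: "0 < r" for x r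
  proof -
    define u :: "real ^ 'n" where "u = (\<chi> i. x $ i - 2 * r)"
    have "qball Q x (2 * r) \<subseteq> cbox u (\<chi> i. u $ i + 4 * r)"
    proof
      fix y assume "y \<in> qball Q x (2 * r)"
      then have "norm (y - x) < 2 * r" by (simp add: qball_def dist_norm norm_minus_commute)
      then have "\<bar>(y - x) $ i\<bar> < 2 * r" for i using component_le_norm_cart[of "y - x" i] by linarith
      then have "\<bar>y $ i - x $ i\<bar> < 2 * r" for i by simp
      then show "y \<in> cbox u (\<chi> i. u $ i + 4 * r)"
        unfolding mem_box_cart u_def by (simp add: abs_less_iff) (smt (verit))
    qed
    then have "measure lebesgue (qball Q x (2 * r)) \<le> measure lebesgue (cbox u (\<chi> i. u $ i + 4 * r))"
      by (intro measure_mono_fmeasurable) (auto intro: fmeasurableD qmeas)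
    then have 1: "measure lebesgue (qball Q x (2 * r)) \<le> (4 * r) ^ ?n"
      using content_cube(1)[of "4 * r" u] r by simp
    have "measure lebesgue (qball Q x (2 * r)) \<le> measure lebesgue (cbox a b)"
      using Q_sub by (intro measure_mono_fmeasurable fmeasurableD[OF qmeas]) (auto simp: qball_def)
    then have "measure lebesgue (qball Q x (2 * r)) \<le> l ^ ?n"
      using content_cube(1)[of l a] l by (simp add: b_def)
    with 1 show ?thesis by (auto simp: min_def)
  qed
  show ?thesis
  proof
    show "Q \<in> lmeasurable" "bounded Q" by fact+
    have m: "(\<chi> i. a $ i + l / 2) \<in> Q" (is "?p \<in> Q") "(\<chi> i. a $ i + l / 4) \<in> Q" (is "?q \<in> Q")
      using l by (auto intro!: subsetD[OF Q_sup] simp: mem_box_cart b_def)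
    then show "Q \<noteq> {}" by auto
    have "?p \<noteq> ?q" using l by (auto simp: vec_eq_iff)
    then have "0 < dist ?p ?q" by simp
    also have "\<dots> \<le> diameter Q" by (rule diameter_bounded_bound[OF bdd m])
    finally show "0 < diameter Q" .
    fix x r assume xr: "x \<in> Q" "0 < (r :: real)"
    have pos: "0 < min (r / ?n) l / 2" using xr l n by simp
    then show "0 < measure lebesgue (qball Q x r)"
      using lower[OF xr] by (meson less_le_trans zero_less_power)
    \<comment> \<open>The factor \<open>8 * ?n\<close> is the ratio of \<open>4 * r\<close> to
      \<open>r / (2 * ?n)\<close>; when \<open>l\<close> is the smaller side it is more than
      enough.\<close>
    have "min (4 * r) l \<le> (8 * real ?n) * (min (r / ?n) l / 2)"
    proof (cases "r / ?n \<le> l")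
      case False
      then have "(8 * real ?n) * (min (r / ?n) l / 2) = 4 * real ?n * l" by (simp add: min_def)
      moreover have "1 * l \<le> 4 * real ?n * l" using l n by (intro mult_right_mono) linarith+
      ultimately show ?thesis by linarith
    qed simp
    then have "(min (4 * r) l) ^ ?n \<le> ((8 * real ?n) * (min (r / ?n) l / 2)) ^ ?n"
      using xr l by (intro power_mono) auto
    also have "\<dots> = (8 * real ?n) ^ ?n * (min (r / ?n) l / 2) ^ ?n" by (rule power_mult_distrib)
    also have "\<dots> \<le> (8 * real ?n) ^ ?n * measure lebesgue (qball Q x r)"
      by (intro mult_left_mono lower xr) auto
    finally show "measure lebesgue (qball Q x (2 * r)) \<le> (8 * real ?n) ^ ?n * measure lebesgue (qball Q x r)"
      using upper[OF xr(2), of x] by linarith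
  qed
qed

theorem corollary1p2:
  fixes Q0 :: "(real ^ 'n) set" and \<alpha> :: real
  assumes "is_cube Q0" and "0 \<le> \<alpha>" and "\<alpha> < real CARD('n)"
  shows "(\<exists>C::real. 0 < C \<and> (\<forall>f \<in> BMO Q0.
            (AE x in lebesgue_on Q0. frac_max \<alpha> Q0 f x < \<infinity>) \<and>
            real_rep (frac_max \<alpha> Q0 f) \<in> BLO Q0 \<and>
            blo_norm Q0 (real_rep (frac_max \<alpha> Q0 f)) \<le> ennreal C * bmo_norm Q0 f)) \<and>
         (\<forall>f \<in> VMO Q0.
            (AE x in lebesgue_on Q0. frac_max \<alpha> Q0 f x < \<infinity>) \<and>
            real_rep (frac_max \<alpha> Q0 f) \<in> VMO Q0)"
proof -
  define D where "D = (8 * real CARD('n)) ^ CARD('n)"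
  interpret doubling_domain Q0 D
    unfolding D_def by (rule is_cube_doubling_domain[OF assms(1)])
  \<comment> \<open>The constant of the BLO bound, which depends only on \<open>\<alpha>\<close>,
    the dimension and the diameter of the cube.\<close>
  have "0 < (2 * diameter Q0) powr \<alpha> * (7 * D ^ 7 + D ^ 2)"
    using Q_diameter_pos D_ge_1 by (intro mult_pos_pos add_pos_pos) auto
  then show ?thesis
    using frac_max_BLO[OF assms(2)] frac_max_VMO[OF assms(2)] BMO_imp_frac_max_finite_AE[OF assms(2)]
    by (auto simp: VMO_def)
qed

end
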